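(* Assume that $\mathcal A$ is compact; that for each $\xi\in\Xi$, $\mathcal C(s,a,\xi)$ and $g(s,a,\xi)$ are continuous in $(s,a)$; and that there are constants $\bar{\mathcal C}_w>0$, $\kappa_w\ge0$ such that $|\mathcal C(s,a,\xi)|\le\bar{\mathcal C}_ww(s)$ and $w(g(s,a,\xi))\le\kappa_ww(s)$ for all $(s,a,\xi)\in\mathcal S\times\mathcal A\times\Xi$, with $\gamma\kappa_w<1$. Then, with respect to any fixed finite sample set $(\hat\xi_1,\dots,\hat\xi_N)$, $$\mathbb P_{\mu_N}\left(\hat V_N^*\ge V^{\hat\pi_N^*}\right)\ge1-\alpha+o(1),$$ where $\hat V_N^*\ge V^{\hat\pi_N^*}$ means $\hat V_N^*(s)\ge V^{\hat\pi_N^*}(s)$ for all $s\in\mathcal S$, and $o(1)$ denotes a quantity that vanishes as $N\to\infty$.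
   Context: $\mathcal S\subseteq\mathbb R^m$ and $\mathcal A\subseteq\mathbb R^n$ are nonempty closed sets; $\Xi=\{\xi^1,\dots,\xi^J\}\subseteq\mathbb R^k$ is a finite set of $J$ distinct points; $\mathscr P(\Xi)$ is the set of probability measures on $\Xi$, identified with the probability vectors $\{P=(p_j)_{j=1}^J\in[0,1]^J:\sum_{j=1}^Jp_j=1\}$ via $p_j=P(\xi=\xi^j)$. $\mathcal C:\mathcal S\times\mathcal A\times\Xi\to\mathbb R$ is the cost, $g:\mathcal S\times\mathcal A\times\Xi\to\mathcal S$ the transition function, $\gamma\in[0,1)$ the discount factor, and $P^c\in\mathscr P(\Xi)$ the unknown true distribution. Posterior and ambiguity set: the prior on $P^c$ is Dirichlet with parameters $\tau_{j,0}>1$; the observations $\hat\xi_1,\hat\xi_2,\dots$ are i.i.d. from the true distribution; $\tau_{j,N}=\tau_{j,0}+\sum_{i=1}^N\mathbf 1_{\{\hat\xi_i=\xi^j\}}$; the posterior $\mu_N$ is the Dirichlet distribution with density proportional to $\prod_{j=1}^Jp_j^{\tau_{j,N}-1}$ on $\mathscr P(\Xi)$. $\mathbb P_{\mu_N}$ is the posterior probability measure: given the data, $P^c$ is treated as a random probability vector with distribution $\mu_N$ (the quantity $\hat V_N^*$ and the policy $\hat\pi_N^*$ below depend only on the data, whereas $V^{\pi}$ depends on $P^c$). Fix $\alpha\in(0,1)$, $\alpha'=\alpha/J$, and let $z_{1-\alpha'/2}$ be the $(1-\alpha'/2)$-quantile of the standard normal distribution. Then $$\hat p_{j,N}=\frac{\tau_{j,N}-1}{\sum_{k=1}^J\tau_{k,N}-J},\qquad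 \hat r_{j,N}=z_{1-\alpha'/2}\sqrt{\frac{\hat p_{j,N}(1-\hat p_{j,N})}{\sum_{k=1}^J\tau_{k,N}-J}},$$ $\hat P_N=(\hat p_{j,N})_j$, $\hat r_N=(\hat r_{j,N})_j$, and $\mathfrak P(P,r)=\{Q\in\mathscr P(\Xi):p_j-r_j\le q_j\le p_j+r_j,\ j=1,\dots,J\}$. Weighted norm: $w:\mathcal S\to[1,\infty)$ is a fixed continuous function, $\|V\|_w=\sup_{s\in\mathcal S}|V(s)|/w(s)$, and $\mathscr V(\mathcal S)=\{V:\mathcal S\to\mathbb R:\|V\|_w<\infty\}$. Operators on $\mathscr V(\mathcal S)$, for a policy $\pi:\mathcal S\to\mathcal A$: $$\hat{\mathcal L}_N(V)(s)=\inf_{a\in\mathcal A}\sup_{P\in\mathfrak P(\hat P_N,\hat r_N)}\mathbb E_P[\mathcal C(s,a,\xi)+\gamma V(g(s,a,\xi))],\qquad \mathcal L^\pi(V)(s)=\mathbb E_{P^c}[\mathcal C(s,\pi(s),\xi)+\gamma V(g(s,\pi(s),\xi))].$$ These are contractions of $(\mathscr V(\mathcal S),\|\cdot\|_w)$; $\hat V_N^*$ and $V^\pi$ denote their unique fixed points. The policy $\hat\pi_N^*$ is optimal for $\hat V_N^*$: for every $s$, $\hat\pi_N^*(s)$ attains $\inf_{a\in\mathcal A}\sup_{P\in\mathfrak P(\hat P_N,\hat r_N)}\mathbb E_P[\mathcal C(s,a,\xi)+\gamma\hat V_N^*(g(s,a,\xi))]$.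
   Formalization: "Any fixed sample set" is read as almost every i.i.d. data sequence, for prior-almost every P^c and for every fixed P^c with all p_j>0; the o(1) may depend on the sequence. For arbitrary data (e.g. all observations equal) the bound can fail. *)

theory Defs
  imports "HOL-Probability.Probability"
begin

text \<open>
  The points of the finite set $\Xi$ are \<open>xi j\<close> for an injective
  \<open>xi :: 'j \<Rightarrow> real ^ 'k\<close> on a finite index type, so \<open>J = CARD('j)\<close>; probability measures
  on $\Xi$ are probability vectors in \<open>real ^ 'j\<close>.
\<close>

definition prob_vecs :: "(real ^ 'j) set" where
  "prob_vecs = {p. (\<forall>j. 0 \<le> p $ j \<and> p $ j \<le> 1) \<and> (\<Sum>j\<in>UNIV. p $ j) = 1}"

definition law :: "('j::finite \<Rightarrow> real ^ 'k) \<Rightarrow> real ^ 'j \<Rightarrow> (real ^ 'k) measure" where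
  "law xi P = distr (point_measure UNIV (\<lambda>j. ennreal (P $ j))) borel xi"

definition expect :: "('j::finite \<Rightarrow> real ^ 'k) \<Rightarrow> real ^ 'j \<Rightarrow> (real ^ 'k \<Rightarrow> real) \<Rightarrow> real" where
  "expect xi P f = (\<Sum>j\<in>UNIV. P $ j * f (xi j))"


text \<open>
  Lebesgue measure on the hyperplane of vectors with coordinate sum \<open>1\<close>, obtained by
  parametrising it by all coordinates but one. The choice of the omitted coordinate is
  immaterial: two such parametrisations differ by a linear change of variables (plus a shift)
  of determinant \<open>\<plusminus>1\<close>.
\<close>

definition sum1_lborel :: "(real ^ 'j) measure" where
  "sum1_lborel = (let i = (SOME i. True) in
     distr (\<Pi>\<^sub>M j\<in>UNIV - {i}. lborel) borel
       (\<lambda>q. \<chi> j. if j = i then 1 - (\<Sum>l\<in>UNIV - {i}. q l) else q j))"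

definition dirichlet_kernel :: "real ^ 'j \<Rightarrow> real ^ 'j \<Rightarrow> ennreal" where
  "dirichlet_kernel tau p =
     ennreal (indicator prob_vecs p * (\<Prod>j\<in>UNIV. (p $ j) powr (tau $ j - 1)))"

definition dirichlet :: "real ^ 'j \<Rightarrow> (real ^ 'j) measure" where
  "dirichlet tau = density sum1_lborel
     (\<lambda>p. dirichlet_kernel tau p / (\<integral>\<^sup>+ q. dirichlet_kernel tau q \<partial>sum1_lborel))"


text \<open>
  The observations are \<open>x 0, x 1, \<dots>\<close>, so that the first \<open>N\<close> of them are \<open>x i\<close> for \<open>i < N\<close>.
\<close>

definition posterior_par ::
  "('j::finite \<Rightarrow> real ^ 'k) \<Rightarrow> real ^ 'j \<Rightarrow> (nat \<Rightarrow> real ^ 'k) \<Rightarrow> nat \<Rightarrow> real ^ 'j" where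
  "posterior_par xi tau0 x N = (\<chi> j. tau0 $ j + (\<Sum>i<N. of_bool (x i = xi j)))"

definition quantile :: "real measure \<Rightarrow> real \<Rightarrow> real" where
  "quantile M q = Inf {z. q \<le> cdf M z}"

definition p_hat :: "real ^ 'j \<Rightarrow> real ^ 'j" where
  "p_hat tau = (\<chi> j. (tau $ j - 1) / ((\<Sum>l\<in>UNIV. tau $ l) - real CARD('j)))"

definition r_hat :: "real \<Rightarrow> real ^ 'j \<Rightarrow> real ^ 'j" where
  "r_hat alpha tau = (\<chi> j.
     quantile std_normal_distribution (1 - (alpha / real CARD('j)) / 2) *
     sqrt (p_hat tau $ j * (1 - p_hat tau $ j) / ((\<Sum>l\<in>UNIV. tau $ l) - real CARD('j))))"

definition box_set :: "real ^ 'j \<Rightarrow> real ^ 'j \<Rightarrow> (real ^ 'j) set" where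
  "box_set p r = {q \<in> prob_vecs. \<forall>j. p $ j - r $ j \<le> q $ j \<and> q $ j \<le> p $ j + r $ j}"

definition ambiguity :: "real \<Rightarrow> real ^ 'j \<Rightarrow> (real ^ 'j) set" where
  "ambiguity alpha tau = box_set (p_hat tau) (r_hat alpha tau)"


text \<open>
  Functions on the state space \<open>S\<close> are represented by total functions that are \<open>undefined\<close>
  outside \<open>S\<close>, so that fixed points of operators on them can be unique.
\<close>

definition wnorm :: "'s set \<Rightarrow> ('s \<Rightarrow> real) \<Rightarrow> ('s \<Rightarrow> real) \<Rightarrow> ereal" where
  "wnorm S w V = (SUP s\<in>S. ereal (\<bar>V s\<bar> / w s))"

definition value_space :: "'s set \<Rightarrow> ('s \<Rightarrow> real) \<Rightarrow> ('s \<Rightarrow> real) set" where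
  "value_space S w = {V \<in> extensional S. wnorm S w V < \<infinity>}"

definition robust_cost ::
  "('j::finite \<Rightarrow> real ^ 'k) \<Rightarrow> ('s \<Rightarrow> 'a \<Rightarrow> real ^ 'k \<Rightarrow> real) \<Rightarrow> ('s \<Rightarrow> 'a \<Rightarrow> real ^ 'k \<Rightarrow> 's)
    \<Rightarrow> real \<Rightarrow> (real ^ 'j) set \<Rightarrow> ('s \<Rightarrow> real) \<Rightarrow> 's \<Rightarrow> 'a \<Rightarrow> real" where
  "robust_cost xi C g gamma U V s a =
     (SUP P\<in>U. expect xi P (\<lambda>y. C s a y + gamma * V (g s a y)))"

definition robust_op ::
  "'s set \<Rightarrow> 'a set \<Rightarrow> ('j::finite \<Rightarrow> real ^ 'k) \<Rightarrow> ('s \<Rightarrow> 'a \<Rightarrow> real ^ 'k \<Rightarrow> real)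
    \<Rightarrow> ('s \<Rightarrow> 'a \<Rightarrow> real ^ 'k \<Rightarrow> 's) \<Rightarrow> real \<Rightarrow> (real ^ 'j) set \<Rightarrow> ('s \<Rightarrow> real) \<Rightarrow> 's \<Rightarrow> real" where
  "robust_op S A xi C g gamma U V = (\<lambda>s\<in>S. INF a\<in>A. robust_cost xi C g gamma U V s a)"

definition policy_op ::
  "'s set \<Rightarrow> ('j::finite \<Rightarrow> real ^ 'k) \<Rightarrow> ('s \<Rightarrow> 'a \<Rightarrow> real ^ 'k \<Rightarrow> real)
    \<Rightarrow> ('s \<Rightarrow> 'a \<Rightarrow> real ^ 'k \<Rightarrow> 's) \<Rightarrow> real \<Rightarrow> real ^ 'j \<Rightarrow> ('s \<Rightarrow> 'a) \<Rightarrow> ('s \<Rightarrow> real) \<Rightarrow> 's \<Rightarrow> real"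
  where
  "policy_op S xi C g gamma P pol V =
     (\<lambda>s\<in>S. expect xi P (\<lambda>y. C s (pol s) y + gamma * V (g s (pol s) y)))"

definition fixed_point :: "'s set \<Rightarrow> ('s \<Rightarrow> real) \<Rightarrow> (('s \<Rightarrow> real) \<Rightarrow> 's \<Rightarrow> real) \<Rightarrow> 's \<Rightarrow> real" where
  "fixed_point S w L = (THE V. V \<in> value_space S w \<and> L V = V)"

definition robust_value ::
  "'s set \<Rightarrow> 'a set \<Rightarrow> ('s \<Rightarrow> real) \<Rightarrow> ('j::finite \<Rightarrow> real ^ 'k) \<Rightarrow> ('s \<Rightarrow> 'a \<Rightarrow> real ^ 'k \<Rightarrow> real)
    \<Rightarrow> ('s \<Rightarrow> 'a \<Rightarrow> real ^ 'k \<Rightarrow> 's) \<Rightarrow> real \<Rightarrow> (real ^ 'j) set \<Rightarrow> 's \<Rightarrow> real" where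
  "robust_value S A w xi C g gamma U = fixed_point S w (robust_op S A xi C g gamma U)"

definition policy_value ::
  "'s set \<Rightarrow> ('s \<Rightarrow> real) \<Rightarrow> ('j::finite \<Rightarrow> real ^ 'k) \<Rightarrow> ('s \<Rightarrow> 'a \<Rightarrow> real ^ 'k \<Rightarrow> real)
    \<Rightarrow> ('s \<Rightarrow> 'a \<Rightarrow> real ^ 'k \<Rightarrow> 's) \<Rightarrow> real \<Rightarrow> real ^ 'j \<Rightarrow> ('s \<Rightarrow> 'a) \<Rightarrow> 's \<Rightarrow> real" where
  "policy_value S w xi C g gamma P pol = fixed_point S w (policy_op S xi C g gamma P pol)"

definition robust_optimal ::
  "'s set \<Rightarrow> 'a set \<Rightarrow> ('s \<Rightarrow> real) \<Rightarrow> ('j::finite \<Rightarrow> real ^ 'k) \<Rightarrow> ('s \<Rightarrow> 'a \<Rightarrow> real ^ 'k \<Rightarrow> real)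
    \<Rightarrow> ('s \<Rightarrow> 'a \<Rightarrow> real ^ 'k \<Rightarrow> 's) \<Rightarrow> real \<Rightarrow> (real ^ 'j) set \<Rightarrow> ('s \<Rightarrow> 'a) \<Rightarrow> bool" where
  "robust_optimal S A w xi C g gamma U pol \<longleftrightarrow>
     pol \<in> S \<rightarrow> A \<and>
     (\<forall>s\<in>S. robust_cost xi C g gamma U (robust_value S A w xi C g gamma U) s (pol s) =
        (INF a\<in>A. robust_cost xi C g gamma U (robust_value S A w xi C g gamma U) s a))"


text \<open>
  The asymptotic bound along one observation sequence \<open>x\<close>: for every choice of optimal policies,
  the posterior probability that the robust value dominates the value of the policy is at
  least \<open>1 - alpha + o(1)\<close>.
\<close>

definition posterior_bound ::
  "'s set \<Rightarrow> 'a set \<Rightarrow> ('s \<Rightarrow> real) \<Rightarrow> ('j::finite \<Rightarrow> real ^ 'k) \<Rightarrow> ('s \<Rightarrow> 'a \<Rightarrow> real ^ 'k \<Rightarrow> real)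
    \<Rightarrow> ('s \<Rightarrow> 'a \<Rightarrow> real ^ 'k \<Rightarrow> 's) \<Rightarrow> real \<Rightarrow> real ^ 'j \<Rightarrow> real \<Rightarrow> (nat \<Rightarrow> real ^ 'k) \<Rightarrow> bool" where
  "posterior_bound S A w xi C g gamma tau0 alpha x \<longleftrightarrow>
    (\<forall>pol. (\<forall>N. robust_optimal S A w xi C g gamma (ambiguity alpha (posterior_par xi tau0 x N))
                 (pol N)) \<longrightarrow>
      (\<exists>e :: nat \<Rightarrow> real. e \<longlonglongrightarrow> 0 \<and>
        (\<forall>N. measure (dirichlet (posterior_par xi tau0 x N))
            {P \<in> prob_vecs. \<forall>s\<in>S.
               robust_value S A w xi C g gamma (ambiguity alpha (posterior_par xi tau0 x N)) s
                 \<ge> policy_value S w xi C g gamma P (pol N) s}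
          \<ge> 1 - alpha + e N)))"

end

theory Submission
  imports Defs "HOL-Real_Asymp.Real_Asymp"
begin

text \<open>
  A distribution \<open>P\<close> in the ambiguity set makes the robust value a supersolution of the policy
  equation for \<open>P\<close>, so by the contraction property it dominates the value of the policy. Hence the
  posterior probability in question is at least that of the ambiguity set, and by the union bound
  it suffices to treat one coordinate. The \<open>j\<close>-th coordinate of the posterior is beta distributed
  with parameters \<open>tau $ j\<close> and \<open>\<Sum>l \<noteq> j. tau $ l\<close>; a Laplace argument (rescaling around the
  mode, with the integrable dominating function \<open>exp ((1 - \<bar>t\<bar>) / 2)\<close>) shows that it is
  asymptotically normal as soon as both parameters tend to infinity. Almost surely they do, since
  every point of positive mass is observed infinitely often.
\<close>

subsection \<open>Robust and policy values\<close>

text \<open>The limiting frequencies of the observations never enter: the standardised marginal is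
  asymptotically normal whatever the ratio of its two parameters, so every estimate is made in a
  scale depending on \<open>N\<close> and no law of large numbers is invoked. A point observed only
  finitely often would keep a bounded posterior parameter, which rules out this argument; hence the
  almost sure form of the result. The centre \<open>p_hat\<close> is the mode of the whole Dirichlet
  vector, whose denominator subtracts \<open>J\<close>, while the mode of a beta marginal subtracts
  2; the resulting shift is of smaller order than the standard deviation. Normalising constants are
  never evaluated: they are shown positive and finite, and cancel in ratios. Two obstacles lie
  outside the asymptotics. Since \<open>measure\<close> is 0 on non-measurable sets, the event, a
  condition on all states at once, must be shown Borel, which is done by proving it closed. And a
  one-point support has no complementary coordinate, so that case is separate.\<close>

lemma expect_mono_add:
  assumes "P \<in> prob_vecs" "\<And>j. f (xi j) \<le> h (xi j) + c"
  shows "expect xi P f \<le> expect xi P h + c"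
proof -
  have "expect xi P f \<le> (\<Sum>j\<in>UNIV. P $ j * (h (xi j) + c))"
    unfolding expect_def using assms by (intro sum_mono mult_left_mono) (auto simp: prob_vecs_def)
  also have "\<dots> = expect xi P h + (\<Sum>j\<in>UNIV. P $ j) * c"
    unfolding expect_def by (simp add: distrib_left sum.distrib sum_distrib_right)
  finally show ?thesis using assms(1) by (simp add: prob_vecs_def)
qed

lemma expect_le:
  assumes "P \<in> prob_vecs" "\<And>j. f (xi j) \<le> c"
  shows "expect xi P f \<le> c"
  using expect_mono_add[of P f xi "\<lambda>_. 0" c] assms by (simp add: expect_def)

lemma expect_ge:
  assumes "P \<in> prob_vecs" "\<And>j. c \<le> f (xi j)"
  shows "c \<le> expect xi P f"
  using expect_mono_add[of P "\<lambda>_. 0" xi f "- c"] assms by (simp add: expect_def)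

lemma bdd_above_expect:
  assumes "U \<subseteq> prob_vecs"
  shows "bdd_above ((\<lambda>P. expect xi P f) ` U)"
proof (rule bdd_aboveI2)
  fix P assume "P \<in> U"
  have "f (xi j) \<le> (\<Sum>j\<in>UNIV. \<bar>f (xi j)\<bar>)" for j
    using member_le_sum[of j UNIV "\<lambda>j. \<bar>f (xi j)\<bar>"] by fastforce
  then show "expect xi P f \<le> (\<Sum>j\<in>UNIV. \<bar>f (xi j)\<bar>)"
    using assms \<open>P \<in> U\<close> by (intro expect_le) auto
qed

section \<open>Fixed points of contractions in the weighted norm\<close>

lemma value_space_iff:
  assumes w: "\<And>s. s \<in> S \<Longrightarrow> 1 \<le> w s"
  shows "V \<in> value_space S w \<longleftrightarrow> V \<in> extensional S \<and> (\<exists>B. \<forall>s\<in>S. \<bar>V s\<bar> \<le> B * w s)"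
proof -
  have le_iff: "\<bar>V s\<bar> / w s \<le> B \<longleftrightarrow> \<bar>V s\<bar> \<le> B * w s" if "s \<in> S" for s B
    using w[OF that] by (simp add: divide_le_eq)
  have "wnorm S w V < \<infinity> \<longleftrightarrow> (\<exists>B. \<forall>s\<in>S. \<bar>V s\<bar> \<le> B * w s)"
  proof
    assume "wnorm S w V < \<infinity>"
    then obtain B where B: "wnorm S w V \<le> ereal B"
      by (metis ereal_infty_less(1) less_eq_ereal_def less_PInf_Ex_of_nat)
    have "\<bar>V s\<bar> \<le> B * w s" if "s \<in> S" for s
    proof -
      have "ereal (\<bar>V s\<bar> / w s) \<le> wnorm S w V"
        unfolding wnorm_def by (intro SUP_upper that)
      with B have "ereal (\<bar>V s\<bar> / w s) \<le> ereal B" by (rule order_trans[rotated])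
      then show ?thesis using le_iff[OF that] by simp
    qed
    then show "\<exists>B. \<forall>s\<in>S. \<bar>V s\<bar> \<le> B * w s" by blast
  next
    assume "\<exists>B. \<forall>s\<in>S. \<bar>V s\<bar> \<le> B * w s"
    then obtain B where "\<forall>s\<in>S. \<bar>V s\<bar> \<le> B * w s" by blast
    then have "wnorm S w V \<le> ereal B"
      unfolding wnorm_def using le_iff by (intro SUP_least) auto
    then show "wnorm S w V < \<infinity>" by (rule order.strict_trans1) simp
  qed
  then show ?thesis by (simp add: value_space_def)
qed

text \<open>Iterating the improvement from \<open>M\<close> to \<open>\<rho> * M\<close> gives the
  bounds \<open>\<rho> ^ n * B * w s\<close>, which tend to 0. Only upper bounds on \<open>D\<close>
  occur, so the same principle serves for uniqueness of fixed points, for comparison of values and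
  for perturbation of the distribution.\<close>

lemma contraction_le_0:
  fixes D w :: "'s \<Rightarrow> real"
  assumes "0 \<le> \<rho>" "\<rho> < 1" and "0 \<le> B"
    and bound: "\<And>s. s \<in> S \<Longrightarrow> D s \<le> B * w s"
    and step: "\<And>M s. 0 \<le> M \<Longrightarrow> (\<And>s. s \<in> S \<Longrightarrow> D s \<le> M * w s) \<Longrightarrow> s \<in> S \<Longrightarrow> D s \<le> \<rho> * M * w s"
    and "s \<in> S"
  shows "D s \<le> 0"
proof -
  have iter: "\<forall>s\<in>S. D s \<le> \<rho> ^ n * B * w s" for n
  proof (induction n)
    case (Suc n)
    then have "D s \<le> \<rho> * (\<rho> ^ n * B) * w s" if "s \<in> S" for s
      using step[of "\<rho> ^ n * B" s] assms(1,3) that by auto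
    then show ?case by (simp add: mult.assoc)
  qed (use bound in simp)
  have "(\<lambda>n. \<rho> ^ n * B * w s) \<longlonglongrightarrow> 0 * B * w s"
    using assms(1,2) by (intro tendsto_intros LIMSEQ_realpow_zero) auto
  then show ?thesis
    using iter \<open>s \<in> S\<close> by (intro LIMSEQ_le_const[of _ 0]) auto
qed

text \<open>Banach's argument, carried out pointwise: Picard iterates converge at each state, with a
  geometric error uniform relative to \<open>w\<close>. This uniformity puts the limit into
  \<open>value_space S w\<close> and lets \<open>L\<close> pass to the limit. Uniqueness matters as
  much as existence because \<open>fixed_point\<close> is a \<open>THE\<close>.\<close>

lemma weighted_contraction_fixed_point:
  fixes L :: "('s \<Rightarrow> real) \<Rightarrow> 's \<Rightarrow> real"
  assumes w: "\<And>s. s \<in> S \<Longrightarrow> 1 \<le> w s" and rho: "0 \<le> \<rho>" "\<rho> < 1"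
    and maps: "\<And>V. V \<in> value_space S w \<Longrightarrow> L V \<in> value_space S w"
    and contr: "\<And>V W M s. V \<in> value_space S w \<Longrightarrow> W \<in> value_space S w \<Longrightarrow> 0 \<le> M \<Longrightarrow>
      (\<And>s. s \<in> S \<Longrightarrow> \<bar>V s - W s\<bar> \<le> M * w s) \<Longrightarrow> s \<in> S \<Longrightarrow> \<bar>L V s - L W s\<bar> \<le> \<rho> * M * w s"
  shows "fixed_point S w L \<in> value_space S w \<and> L (fixed_point S w L) = fixed_point S w L"
proof -
  have vs: "V \<in> value_space S w \<longleftrightarrow> V \<in> extensional S \<and> (\<exists>B. \<forall>s\<in>S. \<bar>V s\<bar> \<le> B * w s)" for V
    using w by (rule value_space_iff)
  \<comment> \<open>Picard iterates from the zero function, restricted to \<open>S\<close> so that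
    they are extensional.\<close>
  define Z where "Z = (\<lambda>n. (L ^^ n) (\<lambda>s\<in>S. 0))"
  have Z_Suc: "Z (Suc n) = L (Z n)" for n by (simp add: Z_def)
  have Z: "Z n \<in> value_space S w" for n
  proof (induction n)
    case 0 show ?case unfolding vs Z_def by (auto intro: exI[of _ 0])
  qed (simp add: Z_Suc maps)
  obtain B0 where B0: "\<And>s. s \<in> S \<Longrightarrow> \<bar>Z 1 s\<bar> \<le> B0 * w s" using Z[of 1] unfolding vs by blast
  \<comment> \<open>The maximum secures the sign that \<open>contr\<close> demands of its constant;
    \<open>B0\<close> may be negative when \<open>S\<close> is empty.\<close>
  define B where "B = max B0 0"
  have "B \<ge> 0" by (simp add: B_def)
  have step: "\<forall>s\<in>S. \<bar>Z (Suc n) s - Z n s\<bar> \<le> \<rho> ^ n * B * w s" for n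
  proof (induction n)
    case 0
    show ?case
    proof
      fix s assume s: "s \<in> S"
      have "\<bar>Z 1 s\<bar> \<le> B * w s"
        using B0[OF s] w[OF s] mult_right_mono[of B0 B "w s"] unfolding B_def by linarith
      then show "\<bar>Z (Suc 0) s - Z 0 s\<bar> \<le> \<rho> ^ 0 * B * w s" using s by (simp add: Z_def)
    qed
  next
    case (Suc n)
    then have "\<bar>L (Z (Suc n)) s - L (Z n) s\<bar> \<le> \<rho> * (\<rho> ^ n * B) * w s" if "s \<in> S" for s
      using \<open>B \<ge> 0\<close> rho that by (intro contr Z) auto
    then show ?case by (simp add: Z_Suc mult.assoc)
  qed
  have sm: "summable (\<lambda>n. \<rho> ^ n * B * w s)" for s
    using rho by (intro summable_mult2 summable_geometric) auto
  have lim_ex: "\<exists>l. (\<lambda>n. Z n s) \<longlonglongrightarrow> l" if "s \<in> S" for s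
  proof -
    have "summable (\<lambda>n. Z (Suc n) s - Z n s)"
      using step that by (intro summable_comparison_test[OF _ sm[of s]]) auto
    then obtain l where "(\<lambda>n. \<Sum>i<n. Z (Suc i) s - Z i s) \<longlonglongrightarrow> l"
      unfolding summable_def sums_def by blast
    then have "(\<lambda>n. Z n s - Z 0 s) \<longlonglongrightarrow> l" by (simp only: sum_lessThan_telescope[of "\<lambda>n. Z n s"])
    then have "(\<lambda>n. Z n s - Z 0 s + Z 0 s) \<longlonglongrightarrow> l + Z 0 s" by (intro tendsto_intros)
    then show ?thesis by auto
  qed
  define V where "V = (\<lambda>s\<in>S. lim (\<lambda>n. Z n s))"
  have lim: "(\<lambda>n. Z n s) \<longlonglongrightarrow> V s" if "s \<in> S" for s
    using lim_ex[OF that] that by (auto simp: V_def dest: limI)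
  \<comment> \<open>The sum of the geometric series of step sizes;
    \<open>B = K * (1 - \<rho>)\<close> makes the next induction close.\<close>
  define K where "K = B / (1 - \<rho>)"
  have "K \<ge> 0" using \<open>B \<ge> 0\<close> rho by (simp add: K_def)
  have tele: "\<bar>Z (n + k) s - Z n s\<bar> \<le> \<rho> ^ n * K * (1 - \<rho> ^ k) * w s" if "s \<in> S" for n k s
  proof (induction k)
    case (Suc k)
    have "\<bar>Z (n + Suc k) s - Z n s\<bar> \<le> \<rho> ^ (n + k) * B * w s + \<rho> ^ n * K * (1 - \<rho> ^ k) * w s"
      using step[of "n + k"] Suc that by fastforce
    also have "B = K * (1 - \<rho>)" using rho by (simp add: K_def)
    finally show ?case by (simp add: algebra_simps power_add)
  qed simp
  \<comment> \<open>Letting \<open>k\<close> tend to infinity in \<open>tele\<close> gives an error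
    bound with one constant for all states; its case \<open>n = 0\<close> is the membership of
    \<open>V\<close> in the value space.\<close>
  have close: "\<bar>V s - Z n s\<bar> \<le> \<rho> ^ n * K * w s" if "s \<in> S" for n s
  proof (rule LIMSEQ_le_const2)
    show "(\<lambda>k. \<bar>Z (k + n) s - Z n s\<bar>) \<longlonglongrightarrow> \<bar>V s - Z n s\<bar>"
      using lim[OF that] by (intro tendsto_intros LIMSEQ_ignore_initial_segment)
    have "\<rho> ^ n * K * (1 - \<rho> ^ k) * w s \<le> \<rho> ^ n * K * 1 * w s" for k
      using rho \<open>K \<ge> 0\<close> w[OF that] by (intro mult_right_mono mult_left_mono) auto
    then have "\<bar>Z (k + n) s - Z n s\<bar> \<le> \<rho> ^ n * K * w s" for k
      using tele[OF that, of n k] by (simp add: add.commute) (meson order_trans)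
    then show "\<exists>N. \<forall>k\<ge>N. \<bar>Z (k + n) s - Z n s\<bar> \<le> \<rho> ^ n * K * w s" by blast
  qed
  have V: "V \<in> value_space S w"
    unfolding vs
  proof (intro conjI exI ballI)
    fix s assume "s \<in> S"
    then show "\<bar>V s\<bar> \<le> K * w s" using close[of s 0] by (simp add: Z_def)
  qed (simp add: V_def)
  \<comment> \<open>The sequence \<open>Z (Suc n) s\<close> converges to \<open>V s\<close> as a
    shifted sequence and to \<open>L V s\<close> by the contraction estimate.\<close>
  have "L V s = V s" if s: "s \<in> S" for s
  proof (rule LIMSEQ_unique)
    show "(\<lambda>n. Z (Suc n) s) \<longlonglongrightarrow> V s" using lim[OF s] by (rule LIMSEQ_Suc)
    have "(\<lambda>n. \<rho> * (\<rho> ^ n * K) * w s) \<longlonglongrightarrow> \<rho> * (0 * K) * w s"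
      using rho by (intro tendsto_intros LIMSEQ_realpow_zero) auto
    moreover have "norm (L (Z n) s - L V s) \<le> \<rho> * (\<rho> ^ n * K) * w s" for n
      unfolding real_norm_def using rho \<open>K \<ge> 0\<close> s close
      by (intro contr Z V) (auto simp: abs_minus_commute)
    ultimately have "(\<lambda>n. L (Z n) s - L V s) \<longlonglongrightarrow> 0"
      using Lim_null_comparison[OF always_eventually, of "\<lambda>n. L (Z n) s - L V s" "\<lambda>n. \<rho> * (\<rho> ^ n * K) * w s"]
      by simp
    then show "(\<lambda>n. Z (Suc n) s) \<longlonglongrightarrow> L V s" unfolding Z_Suc by (rule LIM_zero_cancel)
  qed
  then have LV: "L V = V"
    using maps[OF V] V by (intro extensionalityI[of _ S]) (auto simp: value_space_def)
  have uniq: "W = V" if W: "W \<in> value_space S w" "L W = W" for W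
  proof (rule extensionalityI[of _ S])
    fix s assume s: "s \<in> S"
    obtain BW where BW: "\<And>s. s \<in> S \<Longrightarrow> \<bar>W s\<bar> \<le> BW * w s" using W(1) unfolding vs by blast
    obtain BV where BV: "\<And>s. s \<in> S \<Longrightarrow> \<bar>V s\<bar> \<le> BV * w s" using V unfolding vs by blast
    have nn: "0 \<le> BW + BV"
    proof -
      have "0 \<le> (BW + BV) * w s" using BW[OF s] BV[OF s] by (simp add: algebra_simps)
      then show ?thesis using w[OF s] by (simp add: zero_le_mult_iff)
    qed
    have "\<bar>W s - V s\<bar> \<le> 0"
    proof (rule contraction_le_0[where S = S and w = w and \<rho> = \<rho> and B = "BW + BV"])
      fix s assume "s \<in> S"
      then show "\<bar>W s - V s\<bar> \<le> (BW + BV) * w s"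
        using BW[of s] BV[of s] by (simp add: algebra_simps)
    next
      fix M s assume "0 \<le> M" "\<And>s. s \<in> S \<Longrightarrow> \<bar>W s - V s\<bar> \<le> M * w s" "s \<in> S"
      then show "\<bar>W s - V s\<bar> \<le> \<rho> * M * w s" using contr[OF W(1) V] W(2) LV by metis
    qed (use rho s nn in auto)
    then show "W s = V s" by simp
  qed (use W V in \<open>auto simp: value_space_def\<close>)
  have "\<exists>!V. V \<in> value_space S w \<and> L V = V" using V LV uniq by blast
  from theI'[OF this] show ?thesis unfolding fixed_point_def .
qed

section \<open>Values of a decision process with weighted growth bounds\<close>

locale weighted_mdp =
  fixes S :: "'s set" and A :: "'a set" and w :: "'s \<Rightarrow> real"
    and xi :: "'j::finite \<Rightarrow> real ^ 'k"
    and C :: "'s \<Rightarrow> 'a \<Rightarrow> real ^ 'k \<Rightarrow> real"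
    and g :: "'s \<Rightarrow> 'a \<Rightarrow> real ^ 'k \<Rightarrow> 's"
    and gamma Cbar kappa :: real
  assumes A_ne: "A \<noteq> {}"
    and g_closed: "\<And>s a j. s \<in> S \<Longrightarrow> a \<in> A \<Longrightarrow> g s a (xi j) \<in> S"
    and w_ge_1: "\<And>s. s \<in> S \<Longrightarrow> 1 \<le> w s"
    and gamma_nonneg: "0 \<le> gamma" and kappa_nonneg: "0 \<le> kappa"
    and C_bound: "\<And>s a j. s \<in> S \<Longrightarrow> a \<in> A \<Longrightarrow> \<bar>C s a (xi j)\<bar> \<le> Cbar * w s"
    and w_growth: "\<And>s a j. s \<in> S \<Longrightarrow> a \<in> A \<Longrightarrow> w (g s a (xi j)) \<le> kappa * w s"
    and gamma_kappa: "gamma * kappa < 1"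
begin

abbreviation stage :: "('s \<Rightarrow> real) \<Rightarrow> 's \<Rightarrow> 'a \<Rightarrow> real ^ 'k \<Rightarrow> real" where
  "stage V s a \<equiv> \<lambda>y. C s a y + gamma * V (g s a y)"

lemma value_space_mem_iff:
  "V \<in> value_space S w \<longleftrightarrow> V \<in> extensional S \<and> (\<exists>B. \<forall>s\<in>S. \<bar>V s\<bar> \<le> B * w s)"
  using w_ge_1 by (rule value_space_iff)

lemma value_bound:
  assumes "V \<in> value_space S w"
  shows "\<exists>B\<ge>0. \<forall>s\<in>S. \<bar>V s\<bar> \<le> B * w s"
proof -
  obtain B where B: "\<And>s. s \<in> S \<Longrightarrow> \<bar>V s\<bar> \<le> B * w s"
    using assms unfolding value_space_mem_iff by blast
  have "\<bar>V s\<bar> \<le> max B 0 * w s" if "s \<in> S" for s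
    using B[OF that] w_ge_1[OF that] mult_right_mono[of B "max B 0" "w s"] by linarith
  then show ?thesis by (intro exI[of _ "max B 0"]) auto
qed

text \<open>One transition may enlarge the weight by \<open>kappa\<close> before discounting by
  \<open>gamma\<close>, so an excess \<open>M\<close> becomes \<open>gamma * kappa * M\<close>. All
  contraction estimates derive from this one-sided inequality, used in both directions where
  absolute values are wanted.\<close>

lemma stage_mono:
  assumes "s \<in> S" "a \<in> A" "0 \<le> M" "\<And>s. s \<in> S \<Longrightarrow> V s \<le> W s + M * w s"
  shows "stage V s a (xi j) \<le> stage W s a (xi j) + gamma * kappa * M * w s"
proof -
  have "V (g s a (xi j)) \<le> W (g s a (xi j)) + M * w (g s a (xi j))"
    using assms g_closed by blast
  also have "\<dots> \<le> W (g s a (xi j)) + M * (kappa * w s)"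
    using assms w_growth by (intro add_left_mono mult_left_mono) auto
  finally show ?thesis
    using mult_left_mono[OF _ gamma_nonneg] by (fastforce simp: algebra_simps)
qed

lemma stage_bound:
  assumes "s \<in> S" "a \<in> A" "0 \<le> B" "\<And>s. s \<in> S \<Longrightarrow> \<bar>V s\<bar> \<le> B * w s"
  shows "\<bar>stage V s a (xi j)\<bar> \<le> (Cbar + gamma * kappa * B) * w s"
proof -
  \<comment> \<open>Comparison with the zero value function in both directions leaves only the bound
    on the cost.\<close>
  have "stage V s a (xi j) \<le> stage (\<lambda>_. 0) s a (xi j) + gamma * kappa * B * w s"
    "stage (\<lambda>_. 0) s a (xi j) \<le> stage V s a (xi j) + gamma * kappa * B * w s"
    using assms by (intro stage_mono; fastforce simp: abs_le_iff)+
  with C_bound[OF assms(1,2), of j] show ?thesis by (simp add: algebra_simps abs_le_iff)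
qed

lemma expect_stage_mono:
  assumes "P \<in> prob_vecs" "s \<in> S" "a \<in> A" "0 \<le> M" "\<And>s. s \<in> S \<Longrightarrow> V s \<le> W s + M * w s"
  shows "expect xi P (stage V s a) \<le> expect xi P (stage W s a) + gamma * kappa * M * w s"
  using assms by (intro expect_mono_add stage_mono) auto

lemma expect_stage_bound:
  assumes "P \<in> prob_vecs" "s \<in> S" "a \<in> A" "0 \<le> B" "\<And>s. s \<in> S \<Longrightarrow> \<bar>V s\<bar> \<le> B * w s"
  shows "\<bar>expect xi P (stage V s a)\<bar> \<le> (Cbar + gamma * kappa * B) * w s"
proof -
  let ?K = "(Cbar + gamma * kappa * B) * w s"
  have *: "\<bar>stage V s a (xi j)\<bar> \<le> ?K" for j
    using assms by (intro stage_bound) auto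
  have "expect xi P (stage V s a) \<le> ?K"
    using * by (intro expect_le assms(1)) (simp add: abs_le_iff)
  moreover have "- ?K \<le> expect xi P (stage V s a)"
    using * by (intro expect_ge assms(1)) (metis abs_le_D2 minus_le_iff)
  ultimately show ?thesis by simp
qed

lemma policy_value_fixed_point:
  assumes P: "P \<in> prob_vecs" and pol: "pol \<in> S \<rightarrow> A"
  shows "policy_value S w xi C g gamma P pol \<in> value_space S w"
    and "\<And>s. s \<in> S \<Longrightarrow> policy_value S w xi C g gamma P pol s =
      expect xi P (stage (policy_value S w xi C g gamma P pol) s (pol s))"
proof -
  let ?L = "policy_op S xi C g gamma P pol"
  have L: "?L V s = expect xi P (stage V s (pol s))" if "s \<in> S" for V s
    using that by (simp add: policy_op_def)
  have fp: "fixed_point S w ?L \<in> value_space S w \<and> ?L (fixed_point S w ?L) = fixed_point S w ?L"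
  proof (rule weighted_contraction_fixed_point)
    show "1 \<le> w s" if "s \<in> S" for s using w_ge_1 that .
    show "0 \<le> gamma * kappa" "gamma * kappa < 1"
      using gamma_nonneg kappa_nonneg gamma_kappa by auto
    show "?L V \<in> value_space S w" if V: "V \<in> value_space S w" for V
    proof -
      from value_bound[OF V] obtain B where "0 \<le> B" "\<And>s. s \<in> S \<Longrightarrow> \<bar>V s\<bar> \<le> B * w s" by blast
      then have "\<forall>s\<in>S. \<bar>?L V s\<bar> \<le> (Cbar + gamma * kappa * B) * w s"
        using P pol by (auto simp: L intro!: expect_stage_bound)
      then show ?thesis unfolding value_space_mem_iff by (auto simp: policy_op_def)
    qed
    show "\<bar>?L V s - ?L W s\<bar> \<le> gamma * kappa * M * w s"
      if "0 \<le> M" "\<And>s. s \<in> S \<Longrightarrow> \<bar>V s - W s\<bar> \<le> M * w s" "s \<in> S" for V W M s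
    proof -
      have "V s \<le> W s + M * w s" "W s \<le> V s + M * w s" if "s \<in> S" for s
        using \<open>\<And>s. s \<in> S \<Longrightarrow> \<bar>V s - W s\<bar> \<le> M * w s\<close>[OF that] by auto
      moreover have "pol s \<in> A" using pol \<open>s \<in> S\<close> by auto
      ultimately have "expect xi P (stage V s (pol s)) \<le> expect xi P (stage W s (pol s)) + gamma * kappa * M * w s"
        "expect xi P (stage W s (pol s)) \<le> expect xi P (stage V s (pol s)) + gamma * kappa * M * w s"
        using \<open>s \<in> S\<close> \<open>0 \<le> M\<close> by (intro expect_stage_mono P; blast)+
      then show ?thesis unfolding L[OF \<open>s \<in> S\<close>] by linarith
    qed
  qed
  show "policy_value S w xi C g gamma P pol \<in> value_space S w"
    using fp by (simp add: policy_value_def)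
  show "policy_value S w xi C g gamma P pol s =
      expect xi P (stage (policy_value S w xi C g gamma P pol) s (pol s))" if "s \<in> S" for s
    using L[OF that] fp unfolding policy_value_def by metis
qed

text \<open>The excess does not depend on \<open>P\<close>, so it survives the supremum.
  Non-emptiness and boundedness are what give the real-valued \<open>SUP\<close> its
  meaning.\<close>

lemma robust_cost_mono:
  assumes U: "U \<subseteq> prob_vecs" "U \<noteq> {}"
    and "s \<in> S" "a \<in> A" "0 \<le> M" "\<And>s. s \<in> S \<Longrightarrow> V s \<le> W s + M * w s"
  shows "robust_cost xi C g gamma U V s a \<le> robust_cost xi C g gamma U W s a + gamma * kappa * M * w s"
  unfolding robust_cost_def
proof (rule cSUP_least[OF U(2)])
  fix P assume P: "P \<in> U"
  have "expect xi P (stage V s a) \<le> expect xi P (stage W s a) + gamma * kappa * M * w s"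
    using P assms by (intro expect_stage_mono) auto
  also have "expect xi P (stage W s a) \<le> (SUP P\<in>U. expect xi P (stage W s a))"
    by (intro cSUP_upper P bdd_above_expect U)
  finally show "expect xi P (stage V s a)
      \<le> (SUP P\<in>U. expect xi P (stage W s a)) + gamma * kappa * M * w s" by simp
qed

lemma robust_cost_bound:
  assumes U: "U \<subseteq> prob_vecs" "U \<noteq> {}"
    and "s \<in> S" "a \<in> A" "0 \<le> B" "\<And>s. s \<in> S \<Longrightarrow> \<bar>V s\<bar> \<le> B * w s"
  shows "\<bar>robust_cost xi C g gamma U V s a\<bar> \<le> (Cbar + gamma * kappa * B) * w s"
proof -
  have *: "\<bar>expect xi P (stage V s a)\<bar> \<le> (Cbar + gamma * kappa * B) * w s" if "P \<in> U" for P
    by (rule expect_stage_bound) (use that assms in blast)+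
  obtain P where P: "P \<in> U" using U by blast
  \<comment> \<open>A single member of \<open>U\<close> suffices for the lower bound on the
    supremum.\<close>
  have "expect xi P (stage V s a) \<le> robust_cost xi C g gamma U V s a"
    unfolding robust_cost_def by (intro cSUP_upper P bdd_above_expect U)
  moreover have "robust_cost xi C g gamma U V s a \<le> (Cbar + gamma * kappa * B) * w s"
    unfolding robust_cost_def using * by (intro cSUP_least U(2)) (auto simp: abs_le_iff)
  ultimately show ?thesis using *[OF P] by (auto simp: abs_le_iff)
qed

lemma robust_value_fixed_point:
  assumes U: "U \<subseteq> prob_vecs" "U \<noteq> {}"
  shows "robust_value S A w xi C g gamma U \<in> value_space S w"
    and "\<And>s. s \<in> S \<Longrightarrow> robust_value S A w xi C g gamma U s =
      (INF a\<in>A. robust_cost xi C g gamma U (robust_value S A w xi C g gamma U) s a)"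
proof -
  let ?R = "robust_cost xi C g gamma U"
  let ?L = "robust_op S A xi C g gamma U"
  have L: "?L V s = (INF a\<in>A. ?R V s a)" if "s \<in> S" for V s
    using that by (simp add: robust_op_def)
  \<comment> \<open>A real-valued \<open>INF\<close> lies below its members only for families
    bounded below; the uniform bound on the robust cost provides this.\<close>
  have bdd: "bdd_below ((\<lambda>a. ?R V s a) ` A)" if "V \<in> value_space S w" "s \<in> S" for V s
  proof -
    from value_bound[OF that(1)] obtain B where "0 \<le> B" "\<And>s. s \<in> S \<Longrightarrow> \<bar>V s\<bar> \<le> B * w s" by blast
    then have "- ((Cbar + gamma * kappa * B) * w s) \<le> ?R V s a" if "a \<in> A" for a
      using robust_cost_bound[OF U \<open>s \<in> S\<close> that, of B V] by (auto simp: abs_le_iff)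
    then show ?thesis by (rule bdd_belowI2)
  qed
  have L_mono: "?L V s \<le> ?L W s + gamma * kappa * M * w s"
    if "V \<in> value_space S w" "0 \<le> M" "\<And>s. s \<in> S \<Longrightarrow> V s \<le> W s + M * w s" "s \<in> S" for V W M s
  proof -
    have "?L V s - gamma * kappa * M * w s \<le> ?L W s"
      unfolding L[OF that(4)]
    proof (rule cINF_greatest[OF A_ne])
      fix a assume a: "a \<in> A"
      have "(INF a\<in>A. ?R V s a) \<le> ?R V s a" by (intro cINF_lower bdd a that)
      also have "\<dots> \<le> ?R W s a + gamma * kappa * M * w s"
        by (intro robust_cost_mono U a that)
      finally show "(INF a\<in>A. ?R V s a) - gamma * kappa * M * w s \<le> ?R W s a" by simp
    qed
    then show ?thesis by simp
  qed
  have fp: "fixed_point S w ?L \<in> value_space S w \<and> ?L (fixed_point S w ?L) = fixed_point S w ?L"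
  proof (rule weighted_contraction_fixed_point)
    show "1 \<le> w s" if "s \<in> S" for s using w_ge_1 that .
    show "0 \<le> gamma * kappa" "gamma * kappa < 1"
      using gamma_nonneg kappa_nonneg gamma_kappa by auto
    show "?L V \<in> value_space S w" if V: "V \<in> value_space S w" for V
    proof -
      from value_bound[OF V] obtain B where B: "0 \<le> B" "\<And>s. s \<in> S \<Longrightarrow> \<bar>V s\<bar> \<le> B * w s" by blast
      have "\<bar>?L V s\<bar> \<le> (Cbar + gamma * kappa * B) * w s" if s: "s \<in> S" for s
      proof -
        have R: "\<bar>?R V s a\<bar> \<le> (Cbar + gamma * kappa * B) * w s" if "a \<in> A" for a
          by (intro robust_cost_bound U s that B)
        obtain a where a: "a \<in> A" using A_ne by blast
        have "?L V s \<le> ?R V s a" unfolding L[OF s] by (intro cINF_lower bdd V s a)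
        moreover have "- ((Cbar + gamma * kappa * B) * w s) \<le> ?L V s"
          unfolding L[OF s] by (rule cINF_greatest[OF A_ne]) (use R in \<open>force simp: abs_le_iff\<close>)
        ultimately show ?thesis using R[OF a] by (auto simp: abs_le_iff)
      qed
      then show ?thesis unfolding value_space_mem_iff by (auto simp: robust_op_def)
    qed
    show "\<bar>?L V s - ?L W s\<bar> \<le> gamma * kappa * M * w s"
      if "V \<in> value_space S w" "W \<in> value_space S w" "0 \<le> M"
        "\<And>s. s \<in> S \<Longrightarrow> \<bar>V s - W s\<bar> \<le> M * w s" "s \<in> S" for V W M s
    proof -
      have "V s \<le> W s + M * w s" "W s \<le> V s + M * w s" if "s \<in> S" for s
        using \<open>\<And>s. s \<in> S \<Longrightarrow> \<bar>V s - W s\<bar> \<le> M * w s\<close>[OF that] by auto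
      then show ?thesis
        using L_mono[of V M W s] L_mono[of W M V s] that by (auto simp: abs_le_iff)
    qed
  qed
  show "robust_value S A w xi C g gamma U \<in> value_space S w"
    using fp by (simp add: robust_value_def)
  show "robust_value S A w xi C g gamma U s =
      (INF a\<in>A. robust_cost xi C g gamma U (robust_value S A w xi C g gamma U) s a)" if "s \<in> S" for s
    using L[OF that] fp unfolding robust_value_def by metis
qed

text \<open>The excess of the policy value over the robust value contracts at every stage: replacing
  the policy value by the robust value inside the expectation costs a factor
  \<open>gamma * kappa\<close>, and what remains is at most the worst-case cost of the same action,
  hence at most the robust value.\<close>

lemma policy_value_le_robust_value:
  assumes U: "U \<subseteq> prob_vecs" and P: "P \<in> U"
    and opt: "robust_optimal S A w xi C g gamma U pol" and s: "s \<in> S"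
  shows "policy_value S w xi C g gamma P pol s \<le> robust_value S A w xi C g gamma U s"
proof -
  let ?V = "robust_value S A w xi C g gamma U" and ?W = "policy_value S w xi C g gamma P pol"
  have U_ne: "U \<noteq> {}" and P': "P \<in> prob_vecs" using U P by auto
  have pol: "pol \<in> S \<rightarrow> A" using opt by (simp add: robust_optimal_def)
  note W = policy_value_fixed_point[OF P' pol] and V = robust_value_fixed_point[OF U U_ne]
  from value_bound[OF V(1)] obtain BV where BV: "0 \<le> BV" "\<And>s. s \<in> S \<Longrightarrow> \<bar>?V s\<bar> \<le> BV * w s" by blast
  from value_bound[OF W(1)] obtain BW where BW: "0 \<le> BW" "\<And>s. s \<in> S \<Longrightarrow> \<bar>?W s\<bar> \<le> BW * w s" by blast
  have "?W s - ?V s \<le> 0"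
  proof (rule contraction_le_0[where S = S and w = w and \<rho> = "gamma * kappa" and B = "BV + BW"])
    show "?W s - ?V s \<le> (BV + BW) * w s" if "s \<in> S" for s
      using BV(2)[OF that] BW(2)[OF that] by (simp add: algebra_simps)
    fix M s assume M: "0 \<le> M" "\<And>s. s \<in> S \<Longrightarrow> ?W s - ?V s \<le> M * w s" and s: "s \<in> S"
    have "?W s = expect xi P (stage ?W s (pol s))" by (rule W(2)[OF s])
    also have "\<dots> \<le> expect xi P (stage ?V s (pol s)) + gamma * kappa * M * w s"
      using M s pol by (intro expect_stage_mono P') (auto simp: algebra_simps)
    \<comment> \<open>The one place where the estimate needs \<open>P\<close> to lie in the
      ambiguity set.\<close>
    also have "expect xi P (stage ?V s (pol s)) \<le> robust_cost xi C g gamma U ?V s (pol s)"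
      unfolding robust_cost_def by (intro cSUP_upper P bdd_above_expect U)
    \<comment> \<open>Optimality turns the cost at the chosen action into the infimum over actions,
      which the fixed point equation identifies with the robust value.\<close>
    also have "\<dots> = ?V s"
      using opt s V(2)[OF s] by (simp add: robust_optimal_def)
    finally show "?W s - ?V s \<le> gamma * kappa * M * w s" by simp
  qed (use gamma_nonneg kappa_nonneg gamma_kappa BV BW s in auto)
  then show ?thesis by simp
qed

text \<open>A Lipschitz estimate in the distribution: exchanging \<open>Q\<close> for
  \<open>P\<close> in one stage costs at most their l1 distance times the stage bound, and
  discounting sums these errors to a factor \<open>1 / (1 - gamma * kappa)\<close>. The constant
  involves a bound on the value under \<open>Q\<close> only, so it stays fixed when \<open>P\<close>
  runs through a sequence converging to \<open>Q\<close>.\<close>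

lemma policy_value_diff_le:
  assumes P: "P \<in> prob_vecs" and Q: "Q \<in> prob_vecs" and pol: "pol \<in> S \<rightarrow> A"
    and B: "0 \<le> B" "\<And>s. s \<in> S \<Longrightarrow> \<bar>policy_value S w xi C g gamma Q pol s\<bar> \<le> B * w s"
    and s: "s \<in> S"
  shows "(1 - gamma * kappa) * (policy_value S w xi C g gamma Q pol s - policy_value S w xi C g gamma P pol s)
    \<le> (\<Sum>j\<in>UNIV. \<bar>Q $ j - P $ j\<bar>) * (Cbar + gamma * kappa * B) * w s"
proof -
  let ?W = "policy_value S w xi C g gamma P pol" and ?V = "policy_value S w xi C g gamma Q pol"
  let ?\<rho> = "gamma * kappa"
  \<comment> \<open>Chosen so that the error of one stage is \<open>(1 - ?\<rho>) * K\<close>; then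
    the value under \<open>P\<close> shifted by \<open>K * w s\<close> is a supersolution for
    \<open>Q\<close>.\<close>
  define K where "K = (\<Sum>j\<in>UNIV. \<bar>Q $ j - P $ j\<bar>) * (Cbar + ?\<rho> * B) / (1 - ?\<rho>)"
  note W = policy_value_fixed_point[OF P pol] and V = policy_value_fixed_point[OF Q pol]
  have \<rho>: "0 \<le> ?\<rho>" "?\<rho> < 1" using gamma_nonneg kappa_nonneg gamma_kappa by auto
  have change: "expect xi Q (stage ?V s (pol s)) \<le>
      expect xi P (stage ?V s (pol s)) + (\<Sum>j\<in>UNIV. \<bar>Q $ j - P $ j\<bar>) * (Cbar + ?\<rho> * B) * w s"
    if s: "s \<in> S" for s
  proof -
    have "expect xi Q (stage ?V s (pol s)) - expect xi P (stage ?V s (pol s))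
        = (\<Sum>j\<in>UNIV. (Q $ j - P $ j) * stage ?V s (pol s) (xi j))"
      unfolding expect_def by (simp add: sum_subtractf[symmetric] left_diff_distrib)
    also have "\<dots> \<le> (\<Sum>j\<in>UNIV. \<bar>Q $ j - P $ j\<bar> * ((Cbar + ?\<rho> * B) * w s))"
    proof (rule sum_mono)
      fix j
      have "\<bar>stage ?V s (pol s) (xi j)\<bar> \<le> (Cbar + ?\<rho> * B) * w s"
        using s pol by (intro stage_bound B) auto
      then have "\<bar>(Q $ j - P $ j) * stage ?V s (pol s) (xi j)\<bar> \<le> \<bar>Q $ j - P $ j\<bar> * ((Cbar + ?\<rho> * B) * w s)"
        unfolding abs_mult by (intro mult_left_mono) auto
      then show "(Q $ j - P $ j) * stage ?V s (pol s) (xi j) \<le> \<bar>Q $ j - P $ j\<bar> * ((Cbar + ?\<rho> * B) * w s)"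
        by linarith
    qed
    also have "\<dots> = (\<Sum>j\<in>UNIV. \<bar>Q $ j - P $ j\<bar>) * (Cbar + ?\<rho> * B) * w s"
      by (simp add: sum_distrib_right mult.assoc)
    finally show ?thesis by simp
  qed
  \<comment> \<open>The stage bound dominates an absolute value at some state and action, which
    fixes its sign.\<close>
  have nn: "0 \<le> K"
  proof -
    obtain s where s: "s \<in> S" using s by blast
    obtain a where a: "a \<in> A" using A_ne by blast
    have "0 \<le> (Cbar + ?\<rho> * B) * w s"
      using stage_bound[OF s a B(1) B(2)] by (meson abs_ge_zero order_trans)
    then have "0 \<le> Cbar + ?\<rho> * B" using w_ge_1[OF s] by (simp add: zero_le_mult_iff)
    then show ?thesis using \<rho> unfolding K_def by (intro divide_nonneg_pos mult_nonneg_nonneg sum_nonneg) auto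
  qed
  have K: "(\<Sum>j\<in>UNIV. \<bar>Q $ j - P $ j\<bar>) * (Cbar + ?\<rho> * B) = (1 - ?\<rho>) * K"
    using \<rho> by (simp add: K_def)
  from value_bound[OF W(1)] obtain BW where BW: "0 \<le> BW" "\<And>s. s \<in> S \<Longrightarrow> \<bar>?W s\<bar> \<le> BW * w s" by blast
  have "?V s - ?W s - K * w s \<le> 0"
  proof (rule contraction_le_0[where S = S and w = w and \<rho> = ?\<rho> and B = "B + BW"])
    show "?V s - ?W s - K * w s \<le> (B + BW) * w s" if "s \<in> S" for s
    proof -
      have "0 \<le> K * w s" using nn w_ge_1[OF that] by simp
      then show ?thesis using B(2)[OF that] BW(2)[OF that] by (simp add: algebra_simps)
    qed
    fix M s assume M: "0 \<le> M" "\<And>s. s \<in> S \<Longrightarrow> ?V s - ?W s - K * w s \<le> M * w s" and s: "s \<in> S"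
    have "?V s \<le> expect xi P (stage ?V s (pol s)) + (1 - ?\<rho>) * K * w s"
      using V(2)[OF s] change[OF s] K by simp
    \<comment> \<open>The errors add up to
      \<open>?\<rho> * (M + K) + (1 - ?\<rho>) * K = ?\<rho> * M + K\<close>, so after subtracting
      \<open>K\<close> only the contracted excess is left.\<close>
    also have "expect xi P (stage ?V s (pol s)) \<le> expect xi P (stage ?W s (pol s)) + ?\<rho> * (M + K) * w s"
    proof (rule expect_stage_mono[OF P s])
      show "?V s \<le> ?W s + (M + K) * w s" if "s \<in> S" for s
        using M(2)[OF that] by (simp add: algebra_simps)
    qed (use M nn pol s in auto)
    also have "expect xi P (stage ?W s (pol s)) = ?W s" using W(2)[OF s] by simp
    finally show "?V s - ?W s - K * w s \<le> ?\<rho> * M * w s" by (simp add: algebra_simps)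
  qed (use \<rho> B BW s in auto)
  then have "(1 - ?\<rho>) * (?V s - ?W s) \<le> (1 - ?\<rho>) * (K * w s)"
    using \<rho> by (intro mult_left_mono) auto
  then show ?thesis unfolding K by (simp only: mult.assoc)
qed

text \<open>This makes the event of the theorem Borel in spite of its quantifier over all states.
  Along a convergent sequence the Lipschitz estimate is applied with the limit as \<open>Q\<close>,
  whose value bound does not change with \<open>n\<close>.\<close>

lemma closed_policy_value_le:
  assumes pol: "pol \<in> S \<rightarrow> A" and "closed (prob_vecs :: (real ^ 'j) set)"
  shows "closed {P \<in> prob_vecs. \<forall>s\<in>S. policy_value S w xi C g gamma P pol s \<le> R s}"
  unfolding closed_sequential_limits
proof (intro allI impI, elim conjE)
  fix P Q assume mem: "\<forall>n. P n \<in> {P \<in> prob_vecs. \<forall>s\<in>S. policy_value S w xi C g gamma P pol s \<le> R s}"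
    and lim: "P \<longlonglongrightarrow> Q"
  let ?V = "\<lambda>P. policy_value S w xi C g gamma P pol"
  have Q: "Q \<in> prob_vecs"
    using assms(2) mem lim unfolding closed_sequential_limits by blast
  from value_bound[OF policy_value_fixed_point(1)[OF Q pol]] obtain B where B: "0 \<le> B" "\<And>s. s \<in> S \<Longrightarrow> \<bar>?V Q s\<bar> \<le> B * w s" by blast
  have "?V Q s \<le> R s" if s: "s \<in> S" for s
  proof -
    have "(\<lambda>n. (\<Sum>j\<in>UNIV. \<bar>Q $ j - P n $ j\<bar>) * (Cbar + gamma * kappa * B) * w s)
        \<longlonglongrightarrow> (\<Sum>j\<in>UNIV. \<bar>Q $ j - Q $ j\<bar>) * (Cbar + gamma * kappa * B) * w s"
      by (intro tendsto_intros lim)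
    moreover have "(1 - gamma * kappa) * (?V Q s - R s)
        \<le> (\<Sum>j\<in>UNIV. \<bar>Q $ j - P n $ j\<bar>) * (Cbar + gamma * kappa * B) * w s" for n
    proof -
      have Pn: "P n \<in> prob_vecs" "?V (P n) s \<le> R s" using mem s by auto
      then have "(1 - gamma * kappa) * (?V Q s - R s) \<le> (1 - gamma * kappa) * (?V Q s - ?V (P n) s)"
        using gamma_kappa by (intro mult_left_mono) auto
      also note policy_value_diff_le[OF Pn(1) Q pol B s]
      finally show ?thesis .
    qed
    ultimately have "(1 - gamma * kappa) * (?V Q s - R s) \<le> 0"
      by (intro LIMSEQ_le_const) auto
    then show ?thesis using gamma_kappa by (simp add: mult_le_0_iff)
  qed
  with Q show "Q \<in> {P \<in> prob_vecs. \<forall>s\<in>S. ?V P s \<le> R s}" by blast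
qed

end

subsection \<open>Normal approximation of the beta distribution\<close>

text \<open>The difference of the two sides vanishes at 0 and has a derivative of constant sign on
  each half-line. The denominator \<open>1 + \<bar>y\<bar>\<close> weakens the quadratic term to
  linear order for large positive \<open>y\<close>, as the growth of the logarithm requires; for
  negative \<open>y\<close> the sharper bound by \<open>y - y\<^sup>2 / 2\<close> is proved and then
  relaxed.\<close>

lemma ln_1_plus_le:
  fixes y :: real
  assumes "- 1 < y"
  shows "ln (1 + y) \<le> y - y\<^sup>2 / (2 * (1 + \<bar>y\<bar>))"
proof (cases "0 \<le> y")
  case True
  have "0 - 0\<^sup>2 / (2 * (1 + 0)) - ln (1 + 0) \<le> y - y\<^sup>2 / (2 * (1 + y)) - ln (1 + y)"
  proof (rule DERIV_nonneg_imp_nondecreasing[OF True])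
    fix x :: real assume x: "0 \<le> x" "x \<le> y"
    have "((\<lambda>x. x - x\<^sup>2 / (2 * (1 + x)) - ln (1 + x)) has_real_derivative
        1 - (2 * x * (2 * (1 + x)) - x\<^sup>2 * 2) / (2 * (1 + x) * (2 * (1 + x))) - 1 / (1 + x)) (at x)"
      using x by (auto intro!: derivative_eq_intros)
    also have "1 - (2 * x * (2 * (1 + x)) - x\<^sup>2 * 2) / (2 * (1 + x) * (2 * (1 + x))) - 1 / (1 + x)
        = x\<^sup>2 / (2 * (1 + x)\<^sup>2)"
      using x by (simp add: divide_simps) (simp add: algebra_simps power2_eq_square power3_eq_cube)
    finally show "\<exists>d. ((\<lambda>x. x - x\<^sup>2 / (2 * (1 + x)) - ln (1 + x)) has_real_derivative d) (at x) \<and> 0 \<le> d"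
      by (intro exI conjI) (assumption, simp)
  qed
  then show ?thesis using True by simp
next
  case False
  have "y - y\<^sup>2 / 2 - ln (1 + y) \<ge> 0 - 0\<^sup>2 / 2 - ln (1 + 0)"
  proof (rule DERIV_nonpos_imp_nonincreasing[of y 0 "\<lambda>x. x - x\<^sup>2 / 2 - ln (1 + x)"])
    fix x :: real assume x: "y \<le> x" "x \<le> 0"
    have "((\<lambda>x. x - x\<^sup>2 / 2 - ln (1 + x)) has_real_derivative 1 - x - 1 / (1 + x)) (at x)"
      using x assms by (auto intro!: derivative_eq_intros)
    also have "1 - x - 1 / (1 + x) = - (x\<^sup>2 / (1 + x))"
      using x assms by (simp add: field_simps power2_eq_square)
    finally show "\<exists>d. ((\<lambda>x. x - x\<^sup>2 / 2 - ln (1 + x)) has_real_derivative d) (at x) \<and> d \<le> 0"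
      using x assms by (intro exI conjI) (assumption, simp)
  qed (use False in simp)
  moreover have "y\<^sup>2 / (2 * (1 + \<bar>y\<bar>)) \<le> y\<^sup>2 / 2"
    by (intro divide_left_mono) auto
  ultimately show ?thesis by simp
qed

text \<open>The unnormalised beta density with parameters \<open>m + 1\<close> and
  \<open>k + 1\<close>; indexing by exponents gives the mode the simple form
  \<open>m / (m + k)\<close>.\<close>

definition beta_kernel :: "real \<Rightarrow> real \<Rightarrow> real \<Rightarrow> real" where
  "beta_kernel m k x = indicator {0..1} x * x powr m * (1 - x) powr k"

lemma beta_kernel_measurable [measurable]: "beta_kernel m k \<in> borel_measurable borel"
  unfolding beta_kernel_def by measurable

lemma beta_kernel_nonneg: "0 \<le> beta_kernel m k x"
  by (simp add: beta_kernel_def)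

text \<open>
  The beta kernel around its mode \<open>m / (m + k)\<close>, rescaled by the standard deviation of its
  Gaussian approximation and normalised by its value at the mode.
\<close>

definition std_beta_kernel :: "real \<Rightarrow> real \<Rightarrow> real \<Rightarrow> real" where
  "std_beta_kernel m k t =
    (let u = sqrt (k / (m * (m + k))); v = sqrt (m / (k * (m + k))) in
     if - 1 < u * t \<and> v * t < 1 then exp (m * ln (1 + u * t) + k * ln (1 - v * t)) else 0)"

lemma std_beta_kernel_measurable [measurable]: "std_beta_kernel m k \<in> borel_measurable borel"
  unfolding std_beta_kernel_def Let_def by measurable

lemma std_beta_kernel_nonneg: "0 \<le> std_beta_kernel m k t"
  by (simp add: std_beta_kernel_def Let_def)

text \<open>With \<open>\<sigma>\<close> the standard deviation of the Gaussian approximation and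
  \<open>x0\<close> the mode, \<open>u\<close> is \<open>\<sigma> / x0\<close> and \<open>v\<close>
  is \<open>\<sigma> / (1 - x0)\<close>. The identity \<open>m * u = k * v\<close> cancels the
  linear terms of the exponent, and the two weights \<open>m * u\<^sup>2\<close> and
  \<open>k * v\<^sup>2\<close> add up to 1.\<close>

lemma std_beta_scale:
  fixes m k :: real
  assumes "0 < m" "0 < k"
  defines "u \<equiv> sqrt (k / (m * (m + k)))" and "v \<equiv> sqrt (m / (k * (m + k)))"
  shows "0 < u" "0 < v" "m * u = k * v" "m * u\<^sup>2 = k / (m + k)" "k * v\<^sup>2 = m / (m + k)"
    "u\<^sup>2 \<le> 1 / m" "v\<^sup>2 \<le> 1 / k"
proof -
  show uv: "0 < u" "0 < v" using assms by (auto simp: u_def v_def)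
  have u2: "u\<^sup>2 = k / (m * (m + k))" and v2: "v\<^sup>2 = m / (k * (m + k))"
    using assms by (auto simp: u_def v_def)
  have "(m * u)\<^sup>2 = (k * v)\<^sup>2"
    unfolding power_mult_distrib u2 v2 using assms(1,2) by (simp add: divide_simps power2_eq_square)
  then show "m * u = k * v" using assms uv by (simp add: power2_eq_iff_nonneg)
  show "m * u\<^sup>2 = k / (m + k)" "k * v\<^sup>2 = m / (m + k)"
    unfolding u2 v2 using assms(1,2) by simp_all
  then have "m * u\<^sup>2 \<le> 1" "k * v\<^sup>2 \<le> 1"
    using assms(1,2) by simp_all
  then show "u\<^sup>2 \<le> 1 / m" "v\<^sup>2 \<le> 1 / k"
    using assms(1,2) by (simp_all add: field_simps)
qed

text \<open>Exponents of at least 1 give \<open>u, v \<le> 1\<close>, so the logarithmic bound may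
  be used with the common denominator \<open>1 + \<bar>t\<bar>\<close>. The linear terms cancel and
  the exponent is at most \<open>- t\<^sup>2 / (2 * (1 + \<bar>t\<bar>))\<close>, which is below
  \<open>(1 - \<bar>t\<bar>) / 2\<close> because
  \<open>t\<^sup>2 - 1 \<le> t\<^sup>2\<close>.\<close>

lemma std_beta_kernel_le:
  assumes "1 \<le> m" "1 \<le> k"
  shows "std_beta_kernel m k t \<le> exp ((1 - \<bar>t\<bar>) / 2)"
proof -
  define u v where "u = sqrt (k / (m * (m + k)))" and "v = sqrt (m / (k * (m + k)))"
  have pos: "0 < m" "0 < k" using assms by auto
  note uv = std_beta_scale[OF pos, folded u_def v_def]
  have le1: "u \<le> 1" "v \<le> 1"
  proof -
    have "u\<^sup>2 \<le> 1" "v\<^sup>2 \<le> 1"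
      using uv(6,7) assms by (auto intro: order_trans)
    then show "u \<le> 1" "v \<le> 1" using uv(1,2) by (auto simp: power_le_one_iff)
  qed
  have *: "c * ln (1 + y) \<le> c * y - c * y\<^sup>2 / (2 * (1 + \<bar>t\<bar>))"
    if "- 1 < y" "\<bar>y\<bar> \<le> \<bar>t\<bar>" "0 \<le> c" for c y
  proof -
    have "y\<^sup>2 / (2 * (1 + \<bar>t\<bar>)) \<le> y\<^sup>2 / (2 * (1 + \<bar>y\<bar>))"
      using that by (intro divide_left_mono) auto
    with ln_1_plus_le[OF that(1)] have "ln (1 + y) \<le> y - y\<^sup>2 / (2 * (1 + \<bar>t\<bar>))" by linarith
    from mult_left_mono[OF this that(3)] show ?thesis by (simp add: algebra_simps)
  qed
  have abs_le: "\<bar>u * t\<bar> \<le> \<bar>t\<bar>" "\<bar>- (v * t)\<bar> \<le> \<bar>t\<bar>"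
    using le1 uv(1,2) by (auto simp: abs_mult intro!: mult_left_le_one_le)
  show ?thesis
  proof (cases "- 1 < u * t \<and> v * t < 1")
    case True
    have "m * ln (1 + u * t) + k * ln (1 - v * t)
        \<le> m * (u * t) - m * (u * t)\<^sup>2 / (2 * (1 + \<bar>t\<bar>)) + (k * (- (v * t)) - k * (- (v * t))\<^sup>2 / (2 * (1 + \<bar>t\<bar>)))"
      using *[of "u * t" m] *[of "- (v * t)" k] True abs_le pos by (intro add_mono) auto
    also have "\<dots> = (m * u - k * v) * t - (m * u\<^sup>2 + k * v\<^sup>2) * (t\<^sup>2 / (2 * (1 + \<bar>t\<bar>)))"
      by (simp add: algebra_simps power_mult_distrib add_divide_distrib)
    also have "\<dots> = - (t\<^sup>2 / (2 * (1 + \<bar>t\<bar>)))"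
      unfolding uv(3-5) using pos by (simp add: add_divide_distrib[symmetric] add.commute)
    also have "\<dots> \<le> (1 - \<bar>t\<bar>) / 2"
    proof -
      have "(\<bar>t\<bar> - 1) * (1 + \<bar>t\<bar>) \<le> t\<^sup>2"
        using power2_abs[of t] by (simp add: algebra_simps power2_eq_square)
      then show ?thesis by (simp add: field_simps)
    qed
    finally show ?thesis using True by (simp add: std_beta_kernel_def Let_def u_def v_def)
  next
    case False
    then have "std_beta_kernel m k t = 0"
      unfolding std_beta_kernel_def Let_def u_def v_def by auto
    then show ?thesis by simp
  qed
qed

text \<open>A second-order expansion of both logarithms. The weights \<open>k N / n N\<close> and
  \<open>m N / n N\<close> need not converge, but they sum to 1, so the limit \<open>- 1 / 2\<close>
  can be split off exactly and the rest is bounded weights times null sequences.\<close>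

lemma std_beta_kernel_tendsto:
  fixes m k :: "nat \<Rightarrow> real"
  assumes m: "filterlim m at_top sequentially" and k: "filterlim k at_top sequentially"
  shows "(\<lambda>N. std_beta_kernel (m N) (k N) t) \<longlonglongrightarrow> exp (- t\<^sup>2 / 2)"
proof (cases "t = 0")
  case True
  then show ?thesis by (simp add: std_beta_kernel_def)
next
  case False
  \<comment> \<open>The coefficient in \<open>ln (1 + y) = y + y\<^sup>2 * h y\<close>. Its limit is
    taken over \<open>y \<noteq> 0\<close>, which is why \<open>t = 0\<close> was treated
    apart.\<close>
  define h :: "real \<Rightarrow> real" where "h y = (ln (1 + y) - y) / y\<^sup>2" for y
  have h: "(h \<longlongrightarrow> - 1 / 2) (at 0)"
    unfolding h_def by real_asymp
  define u v where "u = (\<lambda>N. sqrt (k N / (m N * (m N + k N))))"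
    and "v = (\<lambda>N. sqrt (m N / (k N * (m N + k N))))"
  define n where "n = (\<lambda>N. m N + k N)"
  have ev: "\<forall>\<^sub>F N in sequentially. 0 < m N \<and> 0 < k N"
    using m k by (intro eventually_conj) (auto simp: filterlim_at_top_dense)
  have null: "x \<longlonglongrightarrow> 0" if "\<forall>\<^sub>F N in sequentially. (x N)\<^sup>2 \<le> 1 / c N" "filterlim c at_top sequentially"
    for x c :: "nat \<Rightarrow> real"
  proof -
    have "(\<lambda>N. inverse (c N)) \<longlonglongrightarrow> 0"
      using that(2) by (rule tendsto_inverse_0_at_top)
    then have "(\<lambda>N. (x N)\<^sup>2) \<longlonglongrightarrow> 0"
      by (rule tendsto_sandwich[OF _ _ tendsto_const, rotated 2])
        (use that(1) in \<open>auto simp: inverse_eq_divide\<close>)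
    then show ?thesis by (simp add: power_tendsto_0_iff)
  qed
  have u0: "u \<longlonglongrightarrow> 0" and v0: "v \<longlonglongrightarrow> 0"
    by (rule null[OF _ m], use ev in eventually_elim, use std_beta_scale(6) in \<open>simp add: u_def\<close>)
      (rule null[OF _ k], use ev in eventually_elim, use std_beta_scale(7) in \<open>simp add: v_def\<close>)
  have pos: "\<forall>\<^sub>F N in sequentially. 0 < u N \<and> 0 < v N"
    using ev by eventually_elim (simp add: u_def v_def)
  have ut: "filterlim (\<lambda>N. u N * t) (at 0) sequentially"
    unfolding filterlim_at
  proof
    show "\<forall>\<^sub>F N in sequentially. u N * t \<in> UNIV \<and> u N * t \<noteq> 0"
      using pos by eventually_elim (use False in auto)
    show "(\<lambda>N. u N * t) \<longlonglongrightarrow> 0" using tendsto_mult_left_zero[OF u0] .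
  qed
  have vt: "filterlim (\<lambda>N. - (v N * t)) (at 0) sequentially"
    unfolding filterlim_at
  proof
    show "\<forall>\<^sub>F N in sequentially. - (v N * t) \<in> UNIV \<and> - (v N * t) \<noteq> 0"
      using pos by eventually_elim (use False in auto)
    show "(\<lambda>N. - (v N * t)) \<longlonglongrightarrow> 0" using tendsto_minus[OF tendsto_mult_left_zero[OF v0]] by simp
  qed
  \<comment> \<open>Centring \<open>h\<close> at its limit makes boundedness of the weights
    sufficient.\<close>
  have weighted: "(\<lambda>N. c N * (h (y N) + 1 / 2)) \<longlonglongrightarrow> 0"
    if "filterlim y (at 0) sequentially" "\<forall>\<^sub>F N in sequentially. \<bar>c N\<bar> \<le> 1" for c y :: "nat \<Rightarrow> real"
  proof -
    have "(\<lambda>N. h (y N)) \<longlonglongrightarrow> - 1 / 2" using filterlim_compose[OF h that(1)] .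
    then have "(\<lambda>N. h (y N) + 1 / 2) \<longlonglongrightarrow> - 1 / 2 + 1 / 2" by (intro tendsto_intros)
    then have "(\<lambda>N. \<bar>h (y N) + 1 / 2\<bar>) \<longlonglongrightarrow> 0" by (simp add: tendsto_rabs_zero)
    then show ?thesis
    proof (rule Lim_null_comparison[rotated])
      show "\<forall>\<^sub>F N in sequentially. norm (c N * (h (y N) + 1 / 2)) \<le> \<bar>h (y N) + 1 / 2\<bar>"
        using that(2) by eventually_elim (auto simp: abs_mult intro: mult_left_le_one_le)
    qed
  qed
  have "(\<lambda>N. k N / n N * (h (u N * t) + 1 / 2)) \<longlonglongrightarrow> 0"
    by (rule weighted[OF ut]) (use ev in eventually_elim, simp add: n_def)
  moreover have "(\<lambda>N. m N / n N * (h (- (v N * t)) + 1 / 2)) \<longlonglongrightarrow> 0"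
    by (rule weighted[OF vt]) (use ev in eventually_elim, simp add: n_def)
  ultimately have "(\<lambda>N. exp (- t\<^sup>2 / 2 + t\<^sup>2 * (k N / n N * (h (u N * t) + 1 / 2) + m N / n N * (h (- (v N * t)) + 1 / 2))))
      \<longlonglongrightarrow> exp (- t\<^sup>2 / 2 + t\<^sup>2 * (0 + 0))"
    by (intro tendsto_intros)
  then have "(\<lambda>N. exp (- t\<^sup>2 / 2 + t\<^sup>2 * (k N / n N * (h (u N * t) + 1 / 2) + m N / n N * (h (- (v N * t)) + 1 / 2))))
      \<longlonglongrightarrow> exp (- t\<^sup>2 / 2)" by simp
  moreover have "\<forall>\<^sub>F N in sequentially. - 1 < u N * t \<and> v N * t < 1"
  proof -
    have "(\<lambda>N. u N * t) \<longlonglongrightarrow> 0" "(\<lambda>N. v N * t) \<longlonglongrightarrow> 0"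
      using tendsto_mult_left_zero[OF u0] tendsto_mult_left_zero[OF v0] by auto
    then show ?thesis by (intro eventually_conj order_tendstoD) auto
  qed
  then have "\<forall>\<^sub>F N in sequentially.
      exp (- t\<^sup>2 / 2 + t\<^sup>2 * (k N / n N * (h (u N * t) + 1 / 2) + m N / n N * (h (- (v N * t)) + 1 / 2)))
      = std_beta_kernel (m N) (k N) t"
    using ev pos
  proof eventually_elim
    case (elim N)
    then have mk: "0 < m N" "0 < k N" and uv: "0 < u N" "0 < v N" by auto
    note sc = std_beta_scale[OF mk]
    have ln_u: "ln (1 + u N * t) = u N * t + (u N * t)\<^sup>2 * h (u N * t)"
      and ln_v: "ln (1 - v N * t) = - (v N * t) + (v N * t)\<^sup>2 * h (- (v N * t))"
      using uv False by (simp_all add: h_def)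
    have "m N * ln (1 + u N * t) + k N * ln (1 - v N * t)
        = (m N * u N - k N * v N) * t + t\<^sup>2 * (m N * (u N)\<^sup>2 * h (u N * t) + k N * (v N)\<^sup>2 * h (- (v N * t)))"
      unfolding ln_u ln_v by (simp add: algebra_simps power_mult_distrib)
    also have "\<dots> = t\<^sup>2 * (k N / n N * h (u N * t) + m N / n N * h (- (v N * t)))"
      using sc by (simp add: u_def v_def n_def)
    also have "\<dots> = - t\<^sup>2 / 2 + t\<^sup>2 * (k N / n N * (h (u N * t) + 1 / 2) + m N / n N * (h (- (v N * t)) + 1 / 2))"
    proof -
      have "k N / n N * (1 / 2) + m N / n N * (1 / 2) = 1 / 2"
        using mk by (simp add: n_def add.commute flip: add_divide_distrib)
      moreover have "K * (x + 1 / 2) + M * (y + 1 / 2) = K * x + M * y + (K * (1 / 2) + M * (1 / 2))"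
        for K M x y :: real by (simp add: distrib_left)
      ultimately show ?thesis by (simp only:) (simp add: distrib_left)
    qed
    finally show ?case using elim by (simp add: std_beta_kernel_def Let_def u_def v_def)
  qed
  ultimately show ?thesis by (rule Lim_transform_eventually)
qed

section \<open>Dominated convergence for the rescaled kernel\<close>

lemma integrable_exp_neg_abs: "integrable lborel (\<lambda>t::real. exp ((1 - \<bar>t\<bar>) / 2))"
proof -
  define f :: "real \<Rightarrow> real" where "f x = indicator {0..} x * exp (- x)" for x
  have [measurable]: "f \<in> borel_measurable borel" unfolding f_def by measurable
  have "(\<integral>\<^sup>+ x. ennreal (f x) \<partial>lborel) = 1"
    using nn_intergal_power_times_exp_Ici[of 0]
    by (simp add: f_def ennreal_mult'' ennreal_indicator mult.commute)
  then have f: "integrable lborel f" by (intro integrableI_nonneg) (auto simp: f_def)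
  have "integrable lborel (\<lambda>t. f (0 + (1 / 2) * t))" "integrable lborel (\<lambda>t. f (0 + (- 1 / 2) * t))"
    by (rule lborel_integrable_real_affine[OF f]; simp)+
  then have "integrable lborel (\<lambda>t. exp (1 / 2) * (f (0 + (1 / 2) * t) + f (0 + (- 1 / 2) * t)))"
    by (intro integrable_mult_right Bochner_Integration.integrable_add)
  then show ?thesis
  proof (rule Bochner_Integration.integrable_bound)
    have "exp ((1 - \<bar>t\<bar>) / 2) = exp (1 / 2) * exp (- (\<bar>t\<bar> / 2))" for t :: real
      by (simp add: diff_divide_distrib flip: exp_add)
    then show "AE t in lborel. norm (exp ((1 - \<bar>t\<bar>) / 2))
        \<le> norm (exp (1 / 2) * (f (0 + (1 / 2) * t) + f (0 + (- 1 / 2) * t)))"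
      by (intro AE_I2) (auto simp: f_def indicator_def abs_if)
  qed measurable
qed

text \<open>The endpoints move with \<open>N\<close>, yet the indicators converge at every point
  other than \<open>a\<close> and \<open>b\<close>, a null set.\<close>

lemma std_beta_kernel_interval_tendsto:
  fixes m k l u :: "nat \<Rightarrow> real"
  assumes m: "filterlim m at_top sequentially" and k: "filterlim k at_top sequentially"
    and l: "l \<longlonglongrightarrow> a" and u: "u \<longlonglongrightarrow> b"
  shows "(\<lambda>N. \<integral>t. indicator {l N..u N} t * std_beta_kernel (m N) (k N) t \<partial>lborel)
    \<longlonglongrightarrow> (\<integral>t. indicator {a..b} t * exp (- t\<^sup>2 / 2) \<partial>lborel)"
proof -
  have "\<forall>\<^sub>F N in sequentially. 1 \<le> m N \<and> 1 \<le> k N"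
    using m k by (intro eventually_conj) (auto simp: filterlim_at_top)
  then obtain N0 where N0: "\<And>N. N \<ge> N0 \<Longrightarrow> 1 \<le> m N \<and> 1 \<le> k N"
    by (auto simp: eventually_sequentially)
  show ?thesis
  \<comment> \<open>The dominating function is available only once both exponents are at least 1,
    hence the shift of the index.\<close>
  proof (rule LIMSEQ_offset[where k = N0],
      rule integral_dominated_convergence[where w = "\<lambda>t. exp ((1 - \<bar>t\<bar>) / 2)"])
    show "AE t in lborel. (\<lambda>N. indicator {l (N + N0)..u (N + N0)} t * std_beta_kernel (m (N + N0)) (k (N + N0)) t)
        \<longlonglongrightarrow> indicator {a..b} t * exp (- t\<^sup>2 / 2)"
      using AE_lborel_singleton[of a] AE_lborel_singleton[of b]
    proof eventually_elim
      case (elim t)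
      have "(\<lambda>N. indicator {l N..u N} t :: real) \<longlonglongrightarrow> indicator {a..b} t"
      proof (cases "a < t \<and> t < b")
        case True
        then have "\<forall>\<^sub>F N in sequentially. l N < t \<and> t < u N"
          using l u by (intro eventually_conj order_tendstoD) auto
        then have "\<forall>\<^sub>F N in sequentially. indicator {l N..u N} t = (1::real)"
          by eventually_elim auto
        then show ?thesis using True by (simp add: tendsto_eventually)
      next
        case False
        with elim have "t < a \<or> b < t" by auto
        then have "\<forall>\<^sub>F N in sequentially. t < l N \<or> u N < t"
          by (metis (mono_tags, lifting) order_tendstoD(1)[OF l] order_tendstoD(2)[OF u] eventually_mono)
        then have "\<forall>\<^sub>F N in sequentially. indicator {l N..u N} t = (0::real)"
          by eventually_elim auto
        moreover have "indicator {a..b} t = (0::real)" using \<open>t < a \<or> b < t\<close> by auto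
        ultimately show ?thesis by (simp add: tendsto_eventually)
      qed
      then have "(\<lambda>N. indicator {l N..u N} t * std_beta_kernel (m N) (k N) t)
          \<longlonglongrightarrow> indicator {a..b} t * exp (- t\<^sup>2 / 2)"
        by (intro tendsto_mult std_beta_kernel_tendsto m k)
      then show ?case by (rule LIMSEQ_ignore_initial_segment)
    qed
    show "AE t in lborel. norm (indicator {l (N + N0)..u (N + N0)} t * std_beta_kernel (m (N + N0)) (k (N + N0)) t)
        \<le> exp ((1 - \<bar>t\<bar>) / 2)" for N
      using N0[of "N + N0"] std_beta_kernel_le[of "m (N + N0)" "k (N + N0)"]
      by (intro AE_I2) (auto simp: std_beta_kernel_nonneg indicator_def)
  qed (use integrable_exp_neg_abs in measurable)
qed

lemma std_beta_kernel_total_tendsto: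
  fixes m k :: "nat \<Rightarrow> real"
  assumes m: "filterlim m at_top sequentially" and k: "filterlim k at_top sequentially"
  shows "(\<lambda>N. \<integral>t. std_beta_kernel (m N) (k N) t \<partial>lborel) \<longlonglongrightarrow> sqrt (2 * pi)"
proof -
  have "\<forall>\<^sub>F N in sequentially. 1 \<le> m N \<and> 1 \<le> k N"
    using m k by (intro eventually_conj) (auto simp: filterlim_at_top)
  then obtain N0 where N0: "\<And>N. N \<ge> N0 \<Longrightarrow> 1 \<le> m N \<and> 1 \<le> k N"
    by (auto simp: eventually_sequentially)
  have "(\<lambda>N. \<integral>t. std_beta_kernel (m N) (k N) t \<partial>lborel) \<longlonglongrightarrow> (\<integral>t. exp (- t\<^sup>2 / 2) \<partial>lborel)"
  proof (rule LIMSEQ_offset[where k = N0],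
      rule integral_dominated_convergence[where w = "\<lambda>t. exp ((1 - \<bar>t\<bar>) / 2)"])
    show "AE t in lborel. (\<lambda>N. std_beta_kernel (m (N + N0)) (k (N + N0)) t) \<longlonglongrightarrow> exp (- t\<^sup>2 / 2)"
      using LIMSEQ_ignore_initial_segment[OF std_beta_kernel_tendsto[OF m k]] by simp
    show "AE t in lborel. norm (std_beta_kernel (m (N + N0)) (k (N + N0)) t) \<le> exp ((1 - \<bar>t\<bar>) / 2)" for N
      using N0[of "N + N0"] std_beta_kernel_le[of "m (N + N0)" "k (N + N0)"]
      by (intro AE_I2) (auto simp: std_beta_kernel_nonneg)
  qed (use integrable_exp_neg_abs in measurable)
  also have "(\<integral>t. exp (- t\<^sup>2 / 2 :: real) \<partial>lborel) = sqrt (2 * pi)"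
  proof -
    have "(\<integral>t. std_normal_density t \<partial>lborel) = 1" by (rule integral_normal_density) simp
    then show ?thesis by (simp add: std_normal_density_def field_simps)
  qed
  finally show ?thesis .
qed

text \<open>Here \<open>\<sigma>\<^sup>2 = x0 * (1 - x0) / (m + k)\<close>, so that
  \<open>\<sigma> = x0 * u = (1 - x0) * v\<close>. Both factors of the kernel then split into their
  values at the mode times \<open>1 + u * t\<close> and \<open>1 - v * t\<close>.\<close>

lemma beta_kernel_mode:
  fixes m k t :: real
  assumes "0 < m" "0 < k"
  defines "x0 \<equiv> m / (m + k)" and "\<sigma> \<equiv> sqrt (m * k / (m + k) ^ 3)"
  shows "beta_kernel m k (x0 + \<sigma> * t) = beta_kernel m k x0 * std_beta_kernel m k t"
    and "0 < beta_kernel m k x0" and "0 < \<sigma>"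
proof -
  define n u v where "n = m + k" and "u = sqrt (k / (m * (m + k)))" and "v = sqrt (m / (k * (m + k)))"
  have n: "0 < n" using assms by (simp add: n_def)
  have x0: "0 < x0" "0 < 1 - x0" "1 - x0 = k / n"
    using assms n by (auto simp: x0_def n_def field_simps)
  show "0 < beta_kernel m k x0" using x0(1,2) by (simp add: beta_kernel_def)
  show \<sigma>: "0 < \<sigma>" using assms by (simp add: \<sigma>_def)
  have s1: "\<sigma> = x0 * u"
  proof -
    have "(x0 * u)\<^sup>2 = m * k / (m + k) ^ 3"
    proof -
      have "(x0 * u)\<^sup>2 = (m / n)\<^sup>2 * (k / (m * n))"
        using assms(1,2) n unfolding power_mult_distrib by (simp add: x0_def u_def n_def)
      then show ?thesis
        using n assms(1) unfolding n_def[symmetric] by (simp add: power2_eq_square power3_eq_cube field_simps)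
    qed
    then show ?thesis using assms(1,2) x0(1,2) unfolding \<sigma>_def by (intro real_sqrt_unique mult_nonneg_nonneg) (simp_all add: u_def)
  qed
  have s2: "\<sigma> = (1 - x0) * v"
  proof -
    have "((1 - x0) * v)\<^sup>2 = m * k / (m + k) ^ 3"
    proof -
      have "((1 - x0) * v)\<^sup>2 = (k / n)\<^sup>2 * (m / (k * n))"
        using assms(1,2) n unfolding x0(3) power_mult_distrib by (simp add: v_def n_def)
      then show ?thesis
        using n assms(2) unfolding n_def[symmetric] by (simp add: power2_eq_square power3_eq_cube field_simps)
    qed
    then show ?thesis using assms(1,2) x0(1,2) unfolding \<sigma>_def by (intro real_sqrt_unique mult_nonneg_nonneg) (simp_all add: v_def)
  qed
  have e1: "x0 + \<sigma> * t = x0 * (1 + u * t)" by (simp add: s1 algebra_simps)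
  have e2: "1 - (x0 + \<sigma> * t) = (1 - x0) * (1 - v * t)" by (simp add: s2 algebra_simps)
  have c1: "0 \<le> x0 + \<sigma> * t \<longleftrightarrow> 0 \<le> 1 + u * t"
    unfolding e1 using x0 by (simp add: zero_le_mult_iff)
  have c2: "x0 + \<sigma> * t \<le> 1 \<longleftrightarrow> 0 \<le> 1 - v * t"
  proof -
    have "x0 + \<sigma> * t \<le> 1 \<longleftrightarrow> 0 \<le> 1 - (x0 + \<sigma> * t)" by linarith
    also have "\<dots> \<longleftrightarrow> 0 \<le> 1 - v * t" unfolding e2 using x0(2) by (simp add: zero_le_mult_iff)
    finally show ?thesis .
  qed
  have "beta_kernel m k (x0 + \<sigma> * t) = (if 0 \<le> 1 + u * t \<and> 0 \<le> 1 - v * t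
      then (x0 * (1 + u * t)) powr m * ((1 - x0) * (1 - v * t)) powr k else 0)"
    unfolding beta_kernel_def e2 using c1 c2 by (auto simp: indicator_def e1)
  also have "\<dots> = x0 powr m * (1 - x0) powr k * std_beta_kernel m k t"
  proof (cases "0 < 1 + u * t \<and> 0 < 1 - v * t")
    case True
    then show ?thesis using x0(1,2)
      by (simp add: std_beta_kernel_def Let_def powr_mult flip: u_def v_def)
        (simp add: powr_def exp_add)
  next
    \<comment> \<open>At the endpoints of the unit interval the kernel vanishes, since
      \<open>0 powr m = 0\<close>; the strict inequalities of \<open>std_beta_kernel\<close>
      therefore match the closed interval.\<close>
    case False
    then have "\<not> (- 1 < u * t \<and> v * t < 1)" by auto
    then have "std_beta_kernel m k t = 0"
      unfolding std_beta_kernel_def Let_def u_def v_def by auto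
    moreover have "1 + u * t = 0 \<or> 1 - v * t = 0 \<or> \<not> (0 \<le> 1 + u * t \<and> 0 \<le> 1 - v * t)"
      using False by linarith
    ultimately show ?thesis by auto
  qed
  also have "x0 powr m * (1 - x0) powr k = beta_kernel m k x0"
    using x0 by (simp add: beta_kernel_def)
  finally show "beta_kernel m k (x0 + \<sigma> * t) = beta_kernel m k x0 * std_beta_kernel m k t" .
qed

text \<open>The substitution \<open>x = x0 + \<sigma> * t\<close> produces the same factor
  \<open>\<sigma> * beta_kernel m k x0\<close> above and below, so the beta function never has to be
  computed.\<close>

lemma beta_kernel_interval_ratio:
  fixes m k :: real
  assumes "0 < m" "0 < k"
  defines "x0 \<equiv> m / (m + k)" and "\<sigma> \<equiv> sqrt (m * k / (m + k) ^ 3)"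
  shows "(\<integral>x. indicator {a..b} x * beta_kernel m k x \<partial>lborel) / (\<integral>x. beta_kernel m k x \<partial>lborel)
    = (\<integral>t. indicator {(a - x0) / \<sigma>..(b - x0) / \<sigma>} t * std_beta_kernel m k t \<partial>lborel)
      / (\<integral>t. std_beta_kernel m k t \<partial>lborel)"
proof -
  note mode = beta_kernel_mode[OF assms(1,2), folded x0_def \<sigma>_def]
  have "(\<integral>x. beta_kernel m k x \<partial>lborel) = \<sigma> * (\<integral>t. beta_kernel m k (x0 + \<sigma> * t) \<partial>lborel)"
    using lborel_integral_real_affine[of \<sigma> "beta_kernel m k" x0] mode(3) by simp
  also have "\<dots> = \<sigma> * beta_kernel m k x0 * (\<integral>t. std_beta_kernel m k t \<partial>lborel)"
    by (simp add: mode(1))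
  finally have 1: "(\<integral>x. beta_kernel m k x \<partial>lborel) = \<dots>" .
  have ind: "indicator {a..b} (x0 + \<sigma> * t) = (indicator {(a - x0) / \<sigma>..(b - x0) / \<sigma>} t :: real)" for t
    using mode(3) by (auto simp: indicator_def field_simps)
  have "(\<integral>x. indicator {a..b} x * beta_kernel m k x \<partial>lborel)
      = \<sigma> * (\<integral>t. indicator {a..b} (x0 + \<sigma> * t) * beta_kernel m k (x0 + \<sigma> * t) \<partial>lborel)"
    using lborel_integral_real_affine[of \<sigma> "\<lambda>x. indicator {a..b} x * beta_kernel m k x" x0] mode(3) by simp
  also have "\<dots> = \<sigma> * (\<integral>t. beta_kernel m k x0 * (indicator {(a - x0) / \<sigma>..(b - x0) / \<sigma>} t * std_beta_kernel m k t) \<partial>lborel)"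
    by (simp add: mode(1) ind mult.left_commute)
  also have "\<dots> = \<sigma> * beta_kernel m k x0 * (\<integral>t. indicator {(a - x0) / \<sigma>..(b - x0) / \<sigma>} t * std_beta_kernel m k t \<partial>lborel)"
    by simp
  finally show ?thesis using 1 mode(2,3) by simp
qed

text \<open>In the standardised coordinate the interval has centre \<open>D N\<close> and half-width
  \<open>z * R N\<close>. The mismatch of denominators only moves the centre by a null sequence and
  rescales the half-width by a factor tending to 1, with no assumption on the ratio of
  \<open>a\<close> and \<open>b\<close>.\<close>

lemma beta_credible_interval_tendsto:
  fixes a b :: "nat \<Rightarrow> real" and J z :: real
  assumes a: "filterlim a at_top sequentially" and b: "filterlim b at_top sequentially"
  defines "p \<equiv> \<lambda>N. (a N - 1) / (a N + b N - J)"
  defines "r \<equiv> \<lambda>N. z * sqrt (p N * (1 - p N) / (a N + b N - J))"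
  shows "(\<lambda>N. (\<integral>x. indicator {p N - r N..p N + r N} x * beta_kernel (a N - 1) (b N - 1) x \<partial>lborel)
      / (\<integral>x. beta_kernel (a N - 1) (b N - 1) x \<partial>lborel))
    \<longlonglongrightarrow> (\<integral>t. indicator {-z..z} t * std_normal_density t \<partial>lborel)"
proof -
  \<comment> \<open>The offset \<open>d\<close> is the difference between the \<open>J\<close>
    subtracted in the Dirichlet mode and the 2 subtracted in the beta mode; thus
    \<open>a N + b N - J = n N - d\<close>.\<close>
  define m k n d where "m = (\<lambda>N. a N - 1)" and "k = (\<lambda>N. b N - 1)"
    and "n = (\<lambda>N. m N + k N)" and "d = J - 2"
  define x0 \<sigma> where "x0 = (\<lambda>N. m N / (m N + k N))" and "\<sigma> = (\<lambda>N. sqrt (m N * k N / (m N + k N) ^ 3))"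
  have m: "filterlim m at_top sequentially" and k: "filterlim k at_top sequentially"
    unfolding m_def k_def using a b filterlim_tendsto_add_at_top[OF tendsto_const[of "-1"]] by fastforce+
  have n: "filterlim n at_top sequentially"
    unfolding n_def by (rule filterlim_at_top_add_at_top[OF m k])
  have nd: "filterlim (\<lambda>N. n N - d) at_top sequentially"
    using filterlim_tendsto_add_at_top[OF tendsto_const[of "-d"] n] by simp
  \<comment> \<open>This is the ratio \<open>n N / (n N - d)\<close> of the two denominators,
    written so that its limit is visible.\<close>
  define q where "q = (\<lambda>N. 1 + d / (n N - d))"
  have "(\<lambda>N. d / (n N - d)) \<longlonglongrightarrow> 0"
    by (intro tendsto_divide_0[OF tendsto_const] filterlim_at_top_imp_at_infinity nd)
  then have q: "q \<longlonglongrightarrow> 1" unfolding q_def using tendsto_add[OF tendsto_const] by fastforce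
  have ev: "\<forall>\<^sub>F N in sequentially. 0 < m N \<and> d < k N \<and> 0 < k N \<and> 0 < n N - d"
    using m k nd unfolding filterlim_at_top_dense by (intro eventually_conj) blast+
  \<comment> \<open>The shift \<open>(p N - x0 N) / \<sigma> N\<close> in closed form; as
    \<open>m N / n N \<le> 1\<close>, its decay comes from \<open>sqrt (k N)\<close> alone.\<close>
  define D where "D = (\<lambda>N. d * q N * sqrt (m N / n N) / sqrt (k N))"
  \<comment> \<open>The half-width for \<open>z = 1\<close>, divided by
    \<open>\<sigma> N\<close>.\<close>
  define R where "R = (\<lambda>N. sqrt ((1 - d / k N) * q N ^ 3))"
  have D: "D \<longlonglongrightarrow> 0"
  proof (rule Lim_null_comparison)
    show "\<forall>\<^sub>F N in sequentially. norm (D N) \<le> \<bar>d * q N\<bar> / sqrt (k N)"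
      using ev
    proof eventually_elim
      case (elim N)
      then have "sqrt (m N / n N) \<le> 1" by (simp add: n_def)
      then have "\<bar>d * q N\<bar> * sqrt (m N / n N) / sqrt (k N) \<le> \<bar>d * q N\<bar> * 1 / sqrt (k N)"
        using elim by (intro divide_right_mono mult_left_mono) auto
      moreover have "0 \<le> m N / n N" using elim by (simp add: n_def)
      ultimately show ?case using elim by (simp add: D_def abs_mult)
    qed
    have "filterlim (\<lambda>N. sqrt (k N)) at_top sequentially"
      using filterlim_compose[OF sqrt_at_top k] .
    then show "(\<lambda>N. \<bar>d * q N\<bar> / sqrt (k N)) \<longlonglongrightarrow> 0"
      by (intro tendsto_divide_0[OF tendsto_rabs[OF tendsto_mult[OF tendsto_const q]]] filterlim_at_top_imp_at_infinity)
  qed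
  have R: "R \<longlonglongrightarrow> 1"
  proof -
    have "(\<lambda>N. d / k N) \<longlonglongrightarrow> 0"
      by (intro tendsto_divide_0[OF tendsto_const] filterlim_at_top_imp_at_infinity k)
    then have "R \<longlonglongrightarrow> sqrt ((1 - 0) * 1 ^ 3)"
      unfolding R_def by (intro tendsto_intros q)
    then show ?thesis by simp
  qed
  have loc: "\<forall>\<^sub>F N in sequentially. (p N - r N - x0 N) / \<sigma> N = D N - z * R N
      \<and> (p N + r N - x0 N) / \<sigma> N = D N + z * R N"
    using ev
  proof eventually_elim
    case (elim N)
    then have mk: "0 < m N" "0 < k N" by auto
    have nN: "0 < n N" "n N = m N + k N" using elim by (auto simp: n_def)
    have ab: "a N + b N - J = n N - d" by (simp add: n_def m_def k_def d_def)
    have p: "p N = m N / (n N - d)" by (simp add: p_def ab m_def)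
    have qN: "q N = n N / (n N - d)" using elim by (simp add: q_def field_simps)
    have \<sigma>: "0 < \<sigma> N" using mk by (simp add: \<sigma>_def)
    have DS: "D N * \<sigma> N = p N - x0 N"
    proof -
      have rt: "sqrt (n N ^ 3) = n N * sqrt (n N)" using nN(1) by (simp add: power3_eq_cube real_sqrt_mult)
      define sm sk sn where "sm = sqrt (m N)" and "sk = sqrt (k N)" and "sn = sqrt (n N)"
      have roots: "0 < sk" "0 < sn" "sm * sm = m N" "sn * sn = n N"
        using mk nN(1) by (auto simp: sm_def sk_def sn_def)
      have "D N * \<sigma> N = d * q N * (sm / sn) / sk * (sm * sk / (n N * sn))"
        unfolding D_def \<sigma>_def nN(2)[symmetric] by (simp add: real_sqrt_divide real_sqrt_mult rt sm_def sk_def sn_def)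
      also have "\<dots> = d * q N * (sm * sm) / (n N * (sn * sn))" using roots(1) by (simp add: mult_ac)
      also have "\<dots> = d * q N * m N / (n N * n N)" unfolding roots ..
      also have "\<dots> = p N - x0 N"
        unfolding p qN x0_def nN(2)[symmetric] using nN(1) elim by (simp add: field_simps)
      finally show ?thesis .
    qed
    have RS: "R N * \<sigma> N = sqrt (p N * (1 - p N) / (a N + b N - J))"
    proof -
      have "(1 - d / k N) * q N ^ 3 * (m N * k N / n N ^ 3) = (k N - d) * m N / (n N - d) ^ 3"
        unfolding qN power_divide using mk nN(1) elim by (simp add: field_simps)
      also have "\<dots> = p N * (1 - p N) / (a N + b N - J)"
      proof -
        have "1 - p N = (k N - d) / (n N - d)" using elim by (simp add: p nN(2) field_simps)
        then show ?thesis unfolding ab by (simp add: p power3_eq_cube)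
      qed
      finally show ?thesis unfolding R_def \<sigma>_def nN(2)[symmetric] by (simp only: flip: real_sqrt_mult)
    qed
    have rN: "r N = z * R N * \<sigma> N" using RS by (simp add: r_def)
    have "p N - r N - x0 N = (D N - z * R N) * \<sigma> N" "p N + r N - x0 N = (D N + z * R N) * \<sigma> N"
      using DS rN by (simp_all add: algebra_simps)
    then show ?case using \<sigma> by simp
  qed
  have "(\<lambda>N. (\<integral>t. indicator {D N - z * R N..D N + z * R N} t * std_beta_kernel (m N) (k N) t \<partial>lborel)
      / (\<integral>t. std_beta_kernel (m N) (k N) t \<partial>lborel))
    \<longlonglongrightarrow> (\<integral>t. indicator {0 - z * 1..0 + z * 1} t * exp (- t\<^sup>2 / 2) \<partial>lborel) / sqrt (2 * pi)"
    by (intro tendsto_divide std_beta_kernel_interval_tendsto std_beta_kernel_total_tendsto m k tendsto_intros D R) simp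
  also have "(\<integral>t. indicator {0 - z * 1..0 + z * 1} t * exp (- t\<^sup>2 / 2) \<partial>lborel) / sqrt (2 * pi)
      = (\<integral>t. indicator {-z..z} t * std_normal_density t \<partial>lborel)"
    by (simp add: std_normal_density_def)
  finally show ?thesis
  proof (rule Lim_transform_eventually)
    show "\<forall>\<^sub>F N in sequentially. (\<integral>t. indicator {D N - z * R N..D N + z * R N} t * std_beta_kernel (m N) (k N) t \<partial>lborel)
        / (\<integral>t. std_beta_kernel (m N) (k N) t \<partial>lborel)
      = (\<integral>x. indicator {p N - r N..p N + r N} x * beta_kernel (a N - 1) (b N - 1) x \<partial>lborel)
        / (\<integral>x. beta_kernel (a N - 1) (b N - 1) x \<partial>lborel)"
      using loc ev
    proof eventually_elim
      case (elim N)
      then show ?case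
        using beta_kernel_interval_ratio[of "m N" "k N" "p N - r N" "p N + r N"]
        unfolding x0_def \<sigma>_def by (simp add: m_def k_def)
    qed
  qed
qed

subsection \<open>Marginals of the Dirichlet distribution\<close>

lemma borel_measurable_vec_lambda:
  fixes f :: "'j::finite \<Rightarrow> 'a \<Rightarrow> real"
  assumes "\<And>j. f j \<in> borel_measurable M"
  shows "(\<lambda>x. \<chi> j. f j x) \<in> borel_measurable M"
proof (subst borel_measurable_euclidean_space, rule ballI)
  fix b :: "real ^ 'j" assume "b \<in> Basis"
  then obtain j where "b = axis j 1" by (auto simp: Basis_vec_def)
  then show "(\<lambda>x. (\<chi> j. f j x) \<bullet> b) \<in> borel_measurable M"
    using assms[of j] by (simp add: inner_axis)
qed

lemma borel_measurable_vec_nth [measurable]: "(\<lambda>p :: real ^ 'j. p $ j) \<in> borel_measurable borel"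
  by (intro borel_measurable_continuous_onI continuous_intros)

lemma closed_prob_vecs: "closed (prob_vecs :: (real ^ 'j) set)"
  unfolding prob_vecs_def
  by (intro closed_Collect_conj closed_Collect_all closed_Collect_le closed_Collect_eq continuous_intros)

lemma prob_vecs_measurable [measurable]: "(prob_vecs :: (real ^ 'j) set) \<in> sets borel"
  using closed_prob_vecs by (rule borel_closed)

lemma prob_vecs_iff: "p \<in> prob_vecs \<longleftrightarrow> (\<forall>j. 0 \<le> p $ j) \<and> (\<Sum>j\<in>UNIV. p $ j) = 1"
proof -
  have "p $ j \<le> 1" if "\<forall>j. 0 \<le> p $ j" "(\<Sum>j\<in>UNIV. p $ j) = 1" for j
    using member_le_sum[of j UNIV "\<lambda>j. p $ j"] that by simp
  then show ?thesis by (auto simp: prob_vecs_def)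
qed

text \<open>The omitted coordinate is a parameter here, whereas \<open>sum1_lborel\<close> fixes one
  by choice: the marginal of a coordinate is easiest to compute when that coordinate is the omitted
  one.\<close>

definition sum1_point :: "'j \<Rightarrow> ('j \<Rightarrow> real) \<Rightarrow> real ^ 'j" where
  "sum1_point i q = (\<chi> j. if j = i then 1 - (\<Sum>l\<in>UNIV - {i}. q l) else q j)"

lemma sum1_point_nth:
  "sum1_point i q $ j = (if j = i then 1 - (\<Sum>l\<in>UNIV - {i}. q l) else q j)"
  by (simp add: sum1_point_def)

lemma sum1_point_measurable [measurable]:
  "sum1_point (i :: 'j::finite) \<in> borel_measurable (\<Pi>\<^sub>M j\<in>UNIV - {i}. lborel)"
  unfolding sum1_point_def by (rule borel_measurable_vec_lambda) (case_tac "j = i"; simp)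

interpretation lborel_prod: product_sigma_finite "\<lambda>_. lborel :: real measure" ..

text \<open>With the coordinates outside \<open>{i, k}\<close> held fixed, the two parametrisations
  differ by the reflection \<open>y \<mapsto> 1 - sum q I - y\<close> of the line, which preserves
  Lebesgue measure.\<close>

lemma nn_integral_sum1_point_swap:
  fixes F :: "real ^ 'j::finite \<Rightarrow> ennreal"
  assumes [measurable]: "F \<in> borel_measurable borel" and ne: "i \<noteq> k"
  shows "(\<integral>\<^sup>+ q. F (sum1_point i q) \<partial>(\<Pi>\<^sub>M j\<in>UNIV - {i}. lborel))
    = (\<integral>\<^sup>+ q. F (sum1_point k q) \<partial>(\<Pi>\<^sub>M j\<in>UNIV - {k}. lborel))"
proof -
  define I where "I = UNIV - {i, k}"
  have ins: "UNIV - {i} = insert k I" "UNIV - {k} = insert i I" "k \<notin> I" "i \<notin> I" "finite I"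
    using ne by (auto simp: I_def)
  have eq: "sum1_point i (q(k := y)) = sum1_point k (q(i := (1 - sum q I) + (- 1) * y))" for q y
  proof -
    have I_sum: "sum (q(l := z)) I = sum q I" if "l \<notin> I" for l z
      using that by (intro sum.cong) auto
    have sums: "(\<Sum>l\<in>UNIV - {i}. (q(k := y)) l) = y + sum q I"
      "(\<Sum>l\<in>UNIV - {k}. (q(i := z)) l) = z + sum q I" for z
      unfolding ins(1,2) using ins(3-5) by (simp_all add: I_sum del: fun_upd_apply) simp_all
    show ?thesis
      unfolding vec_eq_iff sum1_point_nth sums using ne by simp
  qed
  have m1[measurable]: "(\<lambda>q. F (sum1_point i q)) \<in> borel_measurable (Pi\<^sub>M (insert k I) (\<lambda>_. lborel))"
    and m2[measurable]: "(\<lambda>q. F (sum1_point k q)) \<in> borel_measurable (Pi\<^sub>M (insert i I) (\<lambda>_. lborel))"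
    using sum1_point_measurable[of i] sum1_point_measurable[of k] unfolding ins by measurable
  have "(\<integral>\<^sup>+ q. F (sum1_point i q) \<partial>(\<Pi>\<^sub>M j\<in>UNIV - {i}. lborel))
      = (\<integral>\<^sup>+ q. \<integral>\<^sup>+ y. F (sum1_point i (q(k := y))) \<partial>lborel \<partial>(\<Pi>\<^sub>M j\<in>I. lborel))"
    unfolding ins(1) by (rule lborel_prod.product_nn_integral_insert) (use ins m1 in auto)
  also have "\<dots> = (\<integral>\<^sup>+ q. \<integral>\<^sup>+ y. F (sum1_point k (q(i := y))) \<partial>lborel \<partial>(\<Pi>\<^sub>M j\<in>I. lborel))"
  proof (rule nn_integral_cong)
    fix q assume "q \<in> space (\<Pi>\<^sub>M j\<in>I. lborel :: real measure)"
    then have [measurable]: "(\<lambda>y. F (sum1_point k (q(i := y)))) \<in> borel_measurable borel"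
      using measurable_compose[OF measurable_component_update[of q I "\<lambda>_. lborel" i] m2] ins by simp
    show "(\<integral>\<^sup>+ y. F (sum1_point i (q(k := y))) \<partial>lborel) = (\<integral>\<^sup>+ y. F (sum1_point k (q(i := y))) \<partial>lborel)"
      unfolding eq
      using nn_integral_real_affine[of "\<lambda>y. F (sum1_point k (q(i := y)))" "- 1" "1 - sum q I"] by simp
  qed
  also have "\<dots> = (\<integral>\<^sup>+ q. F (sum1_point k q) \<partial>(\<Pi>\<^sub>M j\<in>UNIV - {k}. lborel))"
    unfolding ins(2) by (rule lborel_prod.product_nn_integral_insert[symmetric]) (use ins m2 in auto)
  finally show ?thesis .
qed

lemma sets_sum1_lborel [simp, measurable_cong]: "sets sum1_lborel = sets borel"
  by (simp add: sum1_lborel_def Let_def)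

lemma nn_integral_sum1_lborel:
  fixes F :: "real ^ 'j::finite \<Rightarrow> ennreal"
  assumes [measurable]: "F \<in> borel_measurable borel"
  shows "(\<integral>\<^sup>+ p. F p \<partial>sum1_lborel) = (\<integral>\<^sup>+ q. F (sum1_point i q) \<partial>(\<Pi>\<^sub>M j\<in>UNIV - {i}. lborel))"
proof -
  define k :: 'j where "k = (SOME i. True)"
  have "(\<integral>\<^sup>+ p. F p \<partial>sum1_lborel) = (\<integral>\<^sup>+ q. F (sum1_point k q) \<partial>(\<Pi>\<^sub>M j\<in>UNIV - {k}. lborel))"
    unfolding sum1_lborel_def Let_def k_def[symmetric] sum1_point_def[symmetric]
    by (subst nn_integral_distr) (auto simp: sum1_point_def[symmetric])
  also have "\<dots> = (\<integral>\<^sup>+ q. F (sum1_point i q) \<partial>(\<Pi>\<^sub>M j\<in>UNIV - {i}. lborel))"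
    by (cases "k = i") (auto intro: nn_integral_sum1_point_swap assms)
  finally show ?thesis .
qed

text \<open>The cut-off at 0 is built into the power so that, on the hyperplane of coordinate sum 1,
  the restriction to the simplex becomes a product over coordinates.\<close>

definition pos_powr :: "real \<Rightarrow> real \<Rightarrow> real" where
  "pos_powr c x = indicator {0..} x * x powr c"

lemma pos_powr_measurable [measurable]: "pos_powr c \<in> borel_measurable borel"
  unfolding pos_powr_def by measurable

lemma pos_powr_nonneg [simp]: "0 \<le> pos_powr c x"
  by (simp add: pos_powr_def)

text \<open>Non-negative exponents bound the kernel by the indicator of the unit interval, and it is
  strictly positive inside. These two facts are all that is used of the normalising
  constant.\<close>

lemma nn_integral_beta_kernel:
  assumes "0 \<le> m" "0 \<le> k"
  shows "0 < (\<integral>\<^sup>+ x. beta_kernel m k x \<partial>lborel)" "(\<integral>\<^sup>+ x. beta_kernel m k x \<partial>lborel) < \<infinity>"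
proof -
  have le: "beta_kernel m k x \<le> indicator {0..1} x" for x
    using assms by (auto simp: beta_kernel_def indicator_def intro!: mult_le_one powr_le1)
  have "(\<integral>\<^sup>+ x. beta_kernel m k x \<partial>lborel) \<le> (\<integral>\<^sup>+ x. indicator {0..1::real} x \<partial>lborel)"
    using le by (intro nn_integral_mono) (auto simp flip: ennreal_indicator intro!: ennreal_leI)
  also have "\<dots> = 1" by simp
  finally show "(\<integral>\<^sup>+ x. beta_kernel m k x \<partial>lborel) < \<infinity>" by (simp add: order.strict_trans1)
  show "0 < (\<integral>\<^sup>+ x. beta_kernel m k x \<partial>lborel)"
  proof (rule ccontr)
    assume "\<not> 0 < (\<integral>\<^sup>+ x. beta_kernel m k x \<partial>lborel)"
    then have "AE x in lborel. ennreal (beta_kernel m k x) = 0"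
      by (simp add: nn_integral_0_iff_AE)
    then have "AE x in lborel. x \<notin> {0<..<1::real}"
      by eventually_elim (auto simp: ennreal_eq_0_iff beta_kernel_def mult_le_0_iff)
    then have "emeasure lborel {0<..<1::real} = 0"
      by (subst (asm) AE_iff_measurable[of "{0<..<1}"]) auto
    then show False by simp
  qed
qed

text \<open>The convolution of two powers is computed by the substitution \<open>x = v * s\<close>.\<close>

lemma pos_powr_convolution:
  assumes "0 \<le> a" "0 \<le> b"
  shows "(\<integral>\<^sup>+ x. ennreal (pos_powr a x) * ennreal (pos_powr b (v - x)) \<partial>lborel)
    = (\<integral>\<^sup>+ x. beta_kernel a b x \<partial>lborel) * ennreal (pos_powr (a + b + 1) v)"
proof (cases "0 < v")
  case True
  have "(\<integral>\<^sup>+ x. ennreal (pos_powr a x) * ennreal (pos_powr b (v - x)) \<partial>lborel)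
      = ennreal \<bar>v\<bar> * (\<integral>\<^sup>+ s. ennreal (pos_powr a (0 + v * s)) * ennreal (pos_powr b (v - (0 + v * s))) \<partial>lborel)"
    using True by (intro nn_integral_real_affine) auto
  also have "(\<lambda>s. ennreal (pos_powr a (0 + v * s)) * ennreal (pos_powr b (v - (0 + v * s))))
      = (\<lambda>s. ennreal (v powr (a + b)) * ennreal (beta_kernel a b s))"
  proof
    fix s
    have 1: "pos_powr a (v * s) = v powr a * (indicator {0..} s * s powr a)"
      using True by (auto simp: pos_powr_def indicator_def zero_le_mult_iff powr_mult)
    have "v - v * s = v * (1 - s)" by (simp add: algebra_simps)
    then have 2: "pos_powr b (v - v * s) = v powr b * (indicator {..1} s * (1 - s) powr b)"
      using True by (auto simp: pos_powr_def indicator_def zero_le_mult_iff powr_mult)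
    have "indicator {0..} s * indicator {..1} s = (indicator {0..1} s :: real)"
      by (auto simp: indicator_def)
    then have "pos_powr a (v * s) * pos_powr b (v - v * s) = v powr (a + b) * beta_kernel a b s"
      unfolding 1 2 beta_kernel_def powr_add by (simp add: mult_ac)
    then show "ennreal (pos_powr a (0 + v * s)) * ennreal (pos_powr b (v - (0 + v * s)))
        = ennreal (v powr (a + b)) * ennreal (beta_kernel a b s)"
      by (simp flip: ennreal_mult add: beta_kernel_nonneg)
  qed
  also have "(\<integral>\<^sup>+ s. ennreal (v powr (a + b)) * ennreal (beta_kernel a b s) \<partial>lborel)
      = ennreal (v powr (a + b)) * (\<integral>\<^sup>+ s. beta_kernel a b s \<partial>lborel)"
    by (rule nn_integral_cmult) simp
  also have "ennreal \<bar>v\<bar> * (ennreal (v powr (a + b)) * (\<integral>\<^sup>+ s. beta_kernel a b s \<partial>lborel))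
      = (\<integral>\<^sup>+ s. beta_kernel a b s \<partial>lborel) * ennreal (v * v powr (a + b))"
    using True by (simp add: ennreal_mult mult_ac)
  also have "v * v powr (a + b) = pos_powr (a + b + 1) v"
    using True by (simp add: pos_powr_def powr_add)
  finally show ?thesis .
next
  case False
  have "(\<integral>\<^sup>+ x. ennreal (pos_powr a x) * ennreal (pos_powr b (v - x)) \<partial>lborel) = (\<integral>\<^sup>+ (x::real). 0 \<partial>lborel)"
  proof (rule nn_integral_cong_AE)
    \<comment> \<open>For \<open>v \<le> 0\<close> both factors can be non-zero only where
      \<open>0 \<le> x \<le> v\<close>, so at most at the null point 0.\<close>
    show "AE x in lborel. ennreal (pos_powr a x) * ennreal (pos_powr b (v - x)) = 0"
      using AE_lborel_singleton[of 0]
      by eventually_elim (use False in \<open>auto simp: pos_powr_def indicator_def\<close>)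
  qed
  moreover have "pos_powr (a + b + 1) v = 0" using False by (auto simp: pos_powr_def indicator_def)
  ultimately show ?thesis by simp
qed

text \<open>Liouville's extension of the Dirichlet integral: coordinates are merged into their sum
  one at a time, each step being a convolution of powers. The exponents \<open>a j\<close>
  correspond to gamma parameters \<open>a j + 1\<close>, which add. The constant is independent of
  \<open>h\<close>, which is what makes it cancel later.\<close>

lemma liouville_formula:
  fixes a :: "'j \<Rightarrow> real"
  assumes "finite I" "I \<noteq> {}" "\<And>j. j \<in> I \<Longrightarrow> 0 \<le> a j"
  shows "\<exists>c. 0 < c \<and> c < \<infinity> \<and> (\<forall>h \<in> borel_measurable borel.
    (\<integral>\<^sup>+ q. (\<Prod>j\<in>I. ennreal (pos_powr (a j) (q j))) * h (\<Sum>j\<in>I. q j) \<partial>(\<Pi>\<^sub>M j\<in>I. lborel))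
      = c * (\<integral>\<^sup>+ u. ennreal (pos_powr ((\<Sum>j\<in>I. a j + 1) - 1) u) * h u \<partial>lborel))"
  using assms
proof (induction I rule: finite_ne_induct)
  case (singleton i)
  show ?case
  proof (intro exI[of _ 1] conjI ballI)
    fix h :: "real \<Rightarrow> ennreal" assume [measurable]: "h \<in> borel_measurable borel"
    show "(\<integral>\<^sup>+ q. (\<Prod>j\<in>{i}. ennreal (pos_powr (a j) (q j))) * h (\<Sum>j\<in>{i}. q j) \<partial>(\<Pi>\<^sub>M j\<in>{i}. lborel))
      = 1 * (\<integral>\<^sup>+ u. ennreal (pos_powr ((\<Sum>j\<in>{i}. a j + 1) - 1) u) * h u \<partial>lborel)"
      using lborel_prod.product_nn_integral_singleton[of "\<lambda>x. ennreal (pos_powr (a i) x) * h x" i] by simp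
  qed auto
next
  case (insert i I)
  define s where "s = (\<Sum>j\<in>I. a j + 1) - 1"
  have "0 \<le> s"
  proof -
    obtain j where j: "j \<in> I" using insert.hyps(2) by blast
    have "a j + 1 \<le> (\<Sum>j\<in>I. a j + 1)"
      using insert.prems insert.hyps(1) j by (intro member_le_sum) (auto intro: add_nonneg_nonneg)
    then show ?thesis using insert.prems j by (force simp: s_def)
  qed
  obtain c where c: "0 < c" "c < \<infinity>" "\<And>h. h \<in> borel_measurable borel \<Longrightarrow>
    (\<integral>\<^sup>+ q. (\<Prod>j\<in>I. ennreal (pos_powr (a j) (q j))) * h (\<Sum>j\<in>I. q j) \<partial>(\<Pi>\<^sub>M j\<in>I. lborel))
      = c * (\<integral>\<^sup>+ u. ennreal (pos_powr s u) * h u \<partial>lborel)"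
    using insert.IH insert.prems unfolding s_def by auto
  define B where "B = (\<integral>\<^sup>+ x. beta_kernel (a i) s x \<partial>lborel)"
  have B: "0 < B" "B < \<infinity>"
    unfolding B_def using nn_integral_beta_kernel[of "a i" s] insert.prems \<open>0 \<le> s\<close> by auto
  show ?case
  proof (intro exI[of _ "c * B"] conjI ballI)
    show "0 < c * B" using c B by (simp add: ennreal_zero_less_mult_iff)
    show "c * B < \<infinity>" using c B by (simp add: ennreal_mult_less_top)
    fix h :: "real \<Rightarrow> ennreal" assume [measurable]: "h \<in> borel_measurable borel"
    let ?G = "\<lambda>q. \<Prod>j\<in>I. ennreal (pos_powr (a j) (q j))"
    have "(\<integral>\<^sup>+ q. (\<Prod>j\<in>insert i I. ennreal (pos_powr (a j) (q j))) * h (\<Sum>j\<in>insert i I. q j) \<partial>(\<Pi>\<^sub>M j\<in>insert i I. lborel))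
        = (\<integral>\<^sup>+ x. \<integral>\<^sup>+ q. (\<Prod>j\<in>insert i I. ennreal (pos_powr (a j) ((q(i := x)) j))) * h (\<Sum>j\<in>insert i I. (q(i := x)) j)
             \<partial>(\<Pi>\<^sub>M j\<in>I. lborel) \<partial>lborel)"
      using insert.hyps by (intro lborel_prod.product_nn_integral_insert_rev) auto
    also have "\<dots> = (\<integral>\<^sup>+ x. \<integral>\<^sup>+ q. ennreal (pos_powr (a i) x) * (?G q * h (x + (\<Sum>j\<in>I. q j)))
             \<partial>(\<Pi>\<^sub>M j\<in>I. lborel) \<partial>lborel)"
    proof (intro nn_integral_cong)
      fix x :: real and q :: "'j \<Rightarrow> real"
      have "(\<Prod>j\<in>I. ennreal (pos_powr (a j) ((q(i := x)) j))) = ?G q"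
        "(\<Sum>j\<in>I. (q(i := x)) j) = (\<Sum>j\<in>I. q j)"
        using insert.hyps by (intro prod.cong sum.cong refl; metis fun_upd_apply)+
      then show "(\<Prod>j\<in>insert i I. ennreal (pos_powr (a j) ((q(i := x)) j))) * h (\<Sum>j\<in>insert i I. (q(i := x)) j)
          = ennreal (pos_powr (a i) x) * (?G q * h (x + (\<Sum>j\<in>I. q j)))"
        using insert.hyps by (simp add: mult.assoc)
    qed
    \<comment> \<open>The induction hypothesis is applied to the translate of \<open>h\<close> by
      the new coordinate \<open>x\<close>.\<close>
    also have "\<dots> = (\<integral>\<^sup>+ x. ennreal (pos_powr (a i) x) * (c * (\<integral>\<^sup>+ u. ennreal (pos_powr s u) * h (x + u) \<partial>lborel)) \<partial>lborel)"
      using insert.hyps c(3)[of "\<lambda>u. h (x + u)" for x]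
      by (intro nn_integral_cong) (subst nn_integral_cmult; simp)
    also have "\<dots> = (\<integral>\<^sup>+ x. c * (\<integral>\<^sup>+ v. ennreal (pos_powr (a i) x) * ennreal (pos_powr s (v - x)) * h v \<partial>lborel) \<partial>lborel)"
    proof (intro nn_integral_cong)
      fix x :: real
      have "(\<integral>\<^sup>+ u. ennreal (pos_powr s u) * h (x + u) \<partial>lborel)
          = (\<integral>\<^sup>+ v. ennreal (pos_powr s (v - x)) * h v \<partial>lborel)"
        using nn_integral_real_affine[of "\<lambda>u. ennreal (pos_powr s u) * h (x + u)" 1 "- x"] by simp
      then have "ennreal (pos_powr (a i) x) * (c * (\<integral>\<^sup>+ u. ennreal (pos_powr s u) * h (x + u) \<partial>lborel))
          = c * (ennreal (pos_powr (a i) x) * (\<integral>\<^sup>+ v. ennreal (pos_powr s (v - x)) * h v \<partial>lborel))"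
        by (simp add: mult.left_commute)
      then show "ennreal (pos_powr (a i) x) * (c * (\<integral>\<^sup>+ u. ennreal (pos_powr s u) * h (x + u) \<partial>lborel))
          = c * (\<integral>\<^sup>+ v. ennreal (pos_powr (a i) x) * ennreal (pos_powr s (v - x)) * h v \<partial>lborel)"
        by (simp add: mult.assoc nn_integral_cmult)
    qed
    also have "\<dots> = c * (\<integral>\<^sup>+ x. \<integral>\<^sup>+ v. ennreal (pos_powr (a i) x) * ennreal (pos_powr s (v - x)) * h v \<partial>lborel \<partial>lborel)"
      by (intro nn_integral_cmult) measurable
    \<comment> \<open>Exchanging the order of integration isolates the convolution in
      \<open>x\<close> for each fixed total \<open>v\<close>.\<close>
    also have "(\<integral>\<^sup>+ x. \<integral>\<^sup>+ v. ennreal (pos_powr (a i) x) * ennreal (pos_powr s (v - x)) * h v \<partial>lborel \<partial>lborel)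
        = (\<integral>\<^sup>+ v. \<integral>\<^sup>+ x. ennreal (pos_powr (a i) x) * ennreal (pos_powr s (v - x)) * h v \<partial>lborel \<partial>lborel)"
      by (rule lborel_pair.Fubini') measurable
    also have "\<dots> = (\<integral>\<^sup>+ v. B * (ennreal (pos_powr (a i + s + 1) v) * h v) \<partial>lborel)"
    proof (rule nn_integral_cong)
      fix v
      have "(\<integral>\<^sup>+ x. ennreal (pos_powr (a i) x) * ennreal (pos_powr s (v - x)) * h v \<partial>lborel)
          = (\<integral>\<^sup>+ x. ennreal (pos_powr (a i) x) * ennreal (pos_powr s (v - x)) \<partial>lborel) * h v"
        by (rule nn_integral_multc) measurable
      also have "\<dots> = B * (ennreal (pos_powr (a i + s + 1) v) * h v)"
        using pos_powr_convolution[of "a i" s v] insert.prems \<open>0 \<le> s\<close> by (simp add: B_def mult.assoc)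
      finally show "(\<integral>\<^sup>+ x. ennreal (pos_powr (a i) x) * ennreal (pos_powr s (v - x)) * h v \<partial>lborel)
          = B * (ennreal (pos_powr (a i + s + 1) v) * h v)" .
    qed
    also have "\<dots> = B * (\<integral>\<^sup>+ v. ennreal (pos_powr (a i + s + 1) v) * h v \<partial>lborel)"
      by (rule nn_integral_cmult) simp
    also have "a i + s + 1 = (\<Sum>j\<in>insert i I. a j + 1) - 1"
      using insert.hyps by (simp add: s_def)
    finally show "(\<integral>\<^sup>+ q. (\<Prod>j\<in>insert i I. ennreal (pos_powr (a j) (q j))) * h (\<Sum>j\<in>insert i I. q j) \<partial>(\<Pi>\<^sub>M j\<in>insert i I. lborel))
      = c * B * (\<integral>\<^sup>+ u. ennreal (pos_powr ((\<Sum>j\<in>insert i I. a j + 1) - 1) u) * h u \<partial>lborel)"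
      by (simp only: mult.assoc)
  qed
qed

lemma dirichlet_kernel_measurable [measurable]: "dirichlet_kernel tau \<in> borel_measurable borel"
  unfolding dirichlet_kernel_def by measurable

text \<open>With \<open>i\<close> omitted, the \<open>i\<close>-th coordinate is 1 minus the sum of
  the others, so every factor that involves it is a function of that sum and the Liouville formula
  applies. The bound on \<open>J\<close> ensures that other coordinates exist.\<close>

lemma dirichlet_kernel_marginal:
  fixes tau :: "real ^ 'j::finite"
  assumes J: "CARD('j) \<ge> 2" and tau: "\<And>j. 1 \<le> tau $ j"
  shows "\<exists>c. 0 < c \<and> c < \<infinity> \<and> (\<forall>f \<in> borel_measurable borel.
    (\<integral>\<^sup>+ p. f (p $ i) * dirichlet_kernel tau p \<partial>sum1_lborel)
      = c * (\<integral>\<^sup>+ x. f x * ennreal (beta_kernel (tau $ i - 1) ((\<Sum>j\<in>UNIV - {i}. tau $ j) - 1) x) \<partial>lborel))"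
proof -
  define I where "I = UNIV - {i}"
  define b where "b = (\<Sum>j\<in>I. tau $ j)"
  have ins: "(UNIV :: 'j set) = insert i I" "i \<notin> I" "finite I" by (auto simp: I_def)
  have "I \<noteq> {}"
  proof
    assume "I = {}"
    then have "(UNIV :: 'j set) = {i}" using ins(1) by simp
    then have "CARD('j) = card {i}" by (rule arg_cong)
    then show False using J by simp
  qed
  then obtain c where c: "0 < c" "c < \<infinity>" "\<And>h. h \<in> borel_measurable borel \<Longrightarrow>
    (\<integral>\<^sup>+ q. (\<Prod>j\<in>I. ennreal (pos_powr (tau $ j - 1) (q j))) * h (\<Sum>j\<in>I. q j) \<partial>(\<Pi>\<^sub>M j\<in>I. lborel))
      = c * (\<integral>\<^sup>+ u. ennreal (pos_powr (b - 1) u) * h u \<partial>lborel)"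
    using liouville_formula[of I "\<lambda>j. tau $ j - 1"] tau ins(3) by (auto simp: b_def)
  have kernel: "dirichlet_kernel tau (sum1_point i q)
      = (\<Prod>j\<in>I. ennreal (pos_powr (tau $ j - 1) (q j))) * ennreal (pos_powr (tau $ i - 1) (1 - sum q I))" for q
  proof -
    let ?p = "sum1_point i q"
    have nth: "?p $ i = 1 - sum q I" "\<And>j. j \<in> I \<Longrightarrow> ?p $ j = q j"
      by (auto simp: sum1_point_nth I_def)
    have "(\<Sum>j\<in>insert i I. ?p $ j) = 1" using ins(2,3) nth by (simp cong: sum.cong)
    then have "(\<Sum>j\<in>UNIV. ?p $ j) = 1" by (simp only: ins(1))
    \<comment> \<open>The sum condition holds by construction, so membership in the simplex reduces
      to the signs of the coordinates.\<close>
    then have mem: "indicator prob_vecs ?p = (\<Prod>j\<in>UNIV. indicator {0..} (?p $ j) :: real)"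
      by (auto simp: prob_vecs_iff indicator_def)
    have "indicator prob_vecs ?p * (\<Prod>j\<in>UNIV. (?p $ j) powr (tau $ j - 1)) = (\<Prod>j\<in>UNIV. pos_powr (tau $ j - 1) (?p $ j))"
      unfolding mem by (simp add: pos_powr_def prod.distrib)
    also have "\<dots> = (\<Prod>j\<in>I. pos_powr (tau $ j - 1) (q j)) * pos_powr (tau $ i - 1) (1 - sum q I)"
      unfolding ins(1) using ins(2,3) nth by (simp add: mult.commute cong: prod.cong)
    finally show ?thesis
      unfolding dirichlet_kernel_def by (simp add: ennreal_mult prod_nonneg prod_ennreal)
  qed
  show ?thesis
  proof (intro exI[of _ c] conjI ballI c)
    fix f :: "real \<Rightarrow> ennreal" assume [measurable]: "f \<in> borel_measurable borel"
    have "(\<integral>\<^sup>+ p. f (p $ i) * dirichlet_kernel tau p \<partial>sum1_lborel)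
        = (\<integral>\<^sup>+ q. f (sum1_point i q $ i) * dirichlet_kernel tau (sum1_point i q) \<partial>(\<Pi>\<^sub>M j\<in>I. lborel))"
      unfolding I_def by (intro nn_integral_sum1_lborel) measurable
    also have "\<dots> = (\<integral>\<^sup>+ q. (\<Prod>j\<in>I. ennreal (pos_powr (tau $ j - 1) (q j)))
          * (f (1 - sum q I) * ennreal (pos_powr (tau $ i - 1) (1 - sum q I))) \<partial>(\<Pi>\<^sub>M j\<in>I. lborel))"
      by (simp add: kernel sum1_point_nth I_def mult_ac)
    also have "\<dots> = c * (\<integral>\<^sup>+ u. ennreal (pos_powr (b - 1) u) * (f (1 - u) * ennreal (pos_powr (tau $ i - 1) (1 - u))) \<partial>lborel)"
      by (rule c(3)) measurable
    also have "(\<integral>\<^sup>+ u. ennreal (pos_powr (b - 1) u) * (f (1 - u) * ennreal (pos_powr (tau $ i - 1) (1 - u))) \<partial>lborel)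
        = (\<integral>\<^sup>+ x. ennreal (pos_powr (b - 1) (1 - x)) * (f x * ennreal (pos_powr (tau $ i - 1) x)) \<partial>lborel)"
      using nn_integral_real_affine[of "\<lambda>u. ennreal (pos_powr (b - 1) u) * (f (1 - u) * ennreal (pos_powr (tau $ i - 1) (1 - u)))" "- 1" 1]
      by simp
    also have "\<dots> = (\<integral>\<^sup>+ x. f x * ennreal (beta_kernel (tau $ i - 1) (b - 1) x) \<partial>lborel)"
    proof (rule nn_integral_cong)
      fix x
      have "beta_kernel (tau $ i - 1) (b - 1) x = pos_powr (b - 1) (1 - x) * pos_powr (tau $ i - 1) x"
        by (auto simp: beta_kernel_def pos_powr_def indicator_def)
      then show "ennreal (pos_powr (b - 1) (1 - x)) * (f x * ennreal (pos_powr (tau $ i - 1) x))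
          = f x * ennreal (beta_kernel (tau $ i - 1) (b - 1) x)"
        by (simp add: ennreal_mult mult_ac)
    qed
    finally show "(\<integral>\<^sup>+ p. f (p $ i) * dirichlet_kernel tau p \<partial>sum1_lborel)
      = c * (\<integral>\<^sup>+ x. f x * ennreal (beta_kernel (tau $ i - 1) ((\<Sum>j\<in>UNIV - {i}. tau $ j) - 1) x) \<partial>lborel)"
      unfolding b_def I_def .
  qed
qed

subsection \<open>Posterior coverage\<close>

lemma sets_dirichlet [simp, measurable_cong]: "sets (dirichlet tau) = sets borel"
  by (simp add: dirichlet_def)

lemma space_dirichlet [simp]: "space (dirichlet tau) = UNIV"
  using sets_eq_imp_space_eq[OF sets_dirichlet[of tau]] by simp

text \<open>Positivity and finiteness turn the \<open>ennreal\<close> quotient in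
  \<open>dirichlet\<close> into a genuine normalisation. For a single point the hyperplane is
  parametrised by an empty product, of total mass 1, on which the kernel is 1.\<close>

lemma dirichlet_normaliser:
  fixes tau :: "real ^ 'j::finite"
  assumes tau: "\<And>j. 1 \<le> tau $ j"
  shows "0 < (\<integral>\<^sup>+ p. dirichlet_kernel tau p \<partial>sum1_lborel)"
    and "(\<integral>\<^sup>+ p. dirichlet_kernel tau p \<partial>sum1_lborel) < \<infinity>"
proof -
  have "0 < (\<integral>\<^sup>+ p. dirichlet_kernel tau p \<partial>sum1_lborel) \<and> (\<integral>\<^sup>+ p. dirichlet_kernel tau p \<partial>sum1_lborel) < \<infinity>"
  proof (cases "CARD('j) \<ge> 2")
    case True
    fix i :: 'j
    have "1 \<le> (\<Sum>j\<in>UNIV - {i}. tau $ j)"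
    proof -
      have "card (UNIV - {i}) \<ge> 1" using True by simp
      moreover have "real (card (UNIV - {i})) * 1 \<le> (\<Sum>j\<in>UNIV - {i}. tau $ j)"
        using tau by (intro sum_bounded_below) auto
      ultimately show ?thesis by linarith
    qed
    with tau[of i] have "0 \<le> tau $ i - 1" "0 \<le> (\<Sum>j\<in>UNIV - {i}. tau $ j) - 1" by auto
    note beta = nn_integral_beta_kernel[OF this]
    obtain c where c: "0 < c" "c < \<infinity>" "\<And>f. f \<in> borel_measurable borel \<Longrightarrow>
        (\<integral>\<^sup>+ p. f (p $ i) * dirichlet_kernel tau p \<partial>sum1_lborel)
        = c * (\<integral>\<^sup>+ x. f x * ennreal (beta_kernel (tau $ i - 1) ((\<Sum>j\<in>UNIV - {i}. tau $ j) - 1) x) \<partial>lborel)"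
      using dirichlet_kernel_marginal[OF True tau, of i] by blast
    show ?thesis
      using c(3)[of "\<lambda>_. 1"] c(1,2) beta by (simp add: ennreal_zero_less_mult_iff ennreal_mult_less_top)
  next
    case False
    then have "CARD('j) = 1" using zero_less_card_finite[where 'a = 'j] by linarith
    then obtain i :: 'j where i: "UNIV = {i}" by (auto simp: card_1_singleton_iff)
    then have all: "l = i" for l by auto
    have "dirichlet_kernel tau (sum1_point i q) = 1" for q
    proof -
      have "UNIV - {i} = {}" using i by simp
      then have "sum1_point i q $ l = 1" for l
        unfolding sum1_point_nth using all[of l] by (metis diff_zero sum.empty)
      moreover have "sum1_point i q \<in> prob_vecs" using calculation by (simp add: prob_vecs_def i)
      ultimately show ?thesis by (simp add: dirichlet_kernel_def)
    qed
    then have "(\<integral>\<^sup>+ p. dirichlet_kernel tau p \<partial>sum1_lborel) = (\<integral>\<^sup>+ q. 1 \<partial>(\<Pi>\<^sub>M j\<in>UNIV - {i}. (lborel :: real measure)))"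
      by (subst nn_integral_sum1_lborel[of _ i]) auto
    also have "UNIV - {i} = {}" using i by simp
    also have "(\<integral>\<^sup>+ q. 1 \<partial>(\<Pi>\<^sub>M j\<in>{}. (lborel :: real measure))) = 1"
      by (simp add: PiM_empty emeasure_count_space)
    finally show ?thesis by simp
  qed
  then show "0 < (\<integral>\<^sup>+ p. dirichlet_kernel tau p \<partial>sum1_lborel)"
    "(\<integral>\<^sup>+ p. dirichlet_kernel tau p \<partial>sum1_lborel) < \<infinity>" by auto
qed

lemma emeasure_dirichlet:
  fixes tau :: "real ^ 'j::finite"
  assumes [measurable]: "X \<in> sets borel"
  shows "emeasure (dirichlet tau) X
    = (\<integral>\<^sup>+ p. indicator X p * dirichlet_kernel tau p \<partial>sum1_lborel) / (\<integral>\<^sup>+ p. dirichlet_kernel tau p \<partial>sum1_lborel)"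
proof -
  let ?Z = "\<integral>\<^sup>+ p. dirichlet_kernel tau p \<partial>sum1_lborel"
  have "emeasure (dirichlet tau) X = (\<integral>\<^sup>+ p. dirichlet_kernel tau p / ?Z * indicator X p \<partial>sum1_lborel)"
    unfolding dirichlet_def by (rule emeasure_density) auto
  also have "\<dots> = (\<integral>\<^sup>+ p. (indicator X p * dirichlet_kernel tau p) * inverse ?Z \<partial>sum1_lborel)"
    by (simp add: divide_ennreal_def mult_ac)
  also have "\<dots> = (\<integral>\<^sup>+ p. indicator X p * dirichlet_kernel tau p \<partial>sum1_lborel) * inverse ?Z"
    by (rule nn_integral_multc) measurable
  finally show ?thesis by (simp add: divide_ennreal_def)
qed

lemma prob_space_dirichlet:
  assumes "\<And>j. 1 \<le> tau $ j"
  shows "prob_space (dirichlet tau)"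
proof (rule prob_spaceI)
  show "emeasure (dirichlet tau) (space (dirichlet tau)) = 1"
    using dirichlet_normaliser[OF assms] emeasure_dirichlet[of UNIV tau]
    by (simp add: ennreal_divide_self)
qed

text \<open>The kernel vanishes wherever a coordinate is 0, because \<open>0 powr c = 0\<close> for
  every \<open>c\<close>. Applied to the prior, this makes all true masses positive almost
  surely.\<close>

lemma AE_dirichlet:
  fixes tau :: "real ^ 'j::finite"
  shows "AE p in dirichlet tau. p \<in> prob_vecs \<and> (\<forall>j. 0 < p $ j)"
proof -
  have "p \<in> prob_vecs \<and> (\<forall>j. 0 < p $ j)" if "0 < dirichlet_kernel tau p / Z" for p :: "real ^ 'j" and Z
  proof -
    have "dirichlet_kernel tau p \<noteq> 0" using that by (auto simp: divide_ennreal_def)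
    then have mem: "p \<in> prob_vecs" and "(\<Prod>j\<in>UNIV. (p $ j) powr (tau $ j - 1)) \<noteq> 0"
      unfolding dirichlet_kernel_def by (metis indicator_simps(2) mult_zero_left ennreal_0, metis mult_zero_right ennreal_0)
    then have "p $ j \<noteq> 0" for j by (auto simp: prod_zero_iff)
    with mem show ?thesis by (auto simp: prob_vecs_def less_le)
  qed
  then show ?thesis
    unfolding dirichlet_def by (subst AE_density) auto
qed

lemma integrable_beta_kernel:
  assumes "0 \<le> m" "0 \<le> k"
  shows "integrable lborel (beta_kernel m k)"
  using nn_integral_beta_kernel[OF assms] by (intro integrableI_nonneg) (auto simp: beta_kernel_nonneg)

lemma measure_dirichlet_component:
  fixes tau :: "real ^ 'j::finite" and i :: 'j
  assumes J: "CARD('j) \<ge> 2" and tau: "\<And>j. 1 \<le> tau $ j" and [measurable]: "X \<in> sets borel"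
  defines "\<beta> \<equiv> beta_kernel (tau $ i - 1) ((\<Sum>j\<in>UNIV - {i}. tau $ j) - 1)"
  shows "measure (dirichlet tau) {p. p $ i \<in> X}
    = (\<integral>x. indicator X x * \<beta> x \<partial>lborel) / (\<integral>x. \<beta> x \<partial>lborel)"
proof -
  have "1 \<le> (\<Sum>j\<in>UNIV - {i}. tau $ j)"
  proof -
    have "card (UNIV - {i}) \<ge> 1" using J by simp
    moreover have "real (card (UNIV - {i})) * 1 \<le> (\<Sum>j\<in>UNIV - {i}. tau $ j)"
      using tau by (intro sum_bounded_below) auto
    ultimately show ?thesis by linarith
  qed
  with tau[of i] have nn: "0 \<le> tau $ i - 1" "0 \<le> (\<Sum>j\<in>UNIV - {i}. tau $ j) - 1" by auto
  note int = integrable_beta_kernel[OF nn, folded \<beta>_def] and pos = nn_integral_beta_kernel[OF nn, folded \<beta>_def]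
  have \<beta>_nn: "0 \<le> \<beta> x" for x by (simp add: \<beta>_def beta_kernel_nonneg)
  have [measurable]: "\<beta> \<in> borel_measurable borel" by (simp add: \<beta>_def)
  have int': "integrable lborel (\<lambda>x. indicator X x * \<beta> x)"
    using int by (rule Bochner_Integration.integrable_bound) (auto simp: indicator_def)
  obtain c where c: "0 < c" "c < \<infinity>" "\<And>f. f \<in> borel_measurable borel \<Longrightarrow>
      (\<integral>\<^sup>+ p. f (p $ i) * dirichlet_kernel tau p \<partial>sum1_lborel) = c * (\<integral>\<^sup>+ x. f x * ennreal (\<beta> x) \<partial>lborel)"
    using dirichlet_kernel_marginal[OF J tau, of i] unfolding \<beta>_def by blast
  have tot: "(\<integral>\<^sup>+ p. dirichlet_kernel tau p \<partial>sum1_lborel) = c * ennreal (\<integral>x. \<beta> x \<partial>lborel)"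
    using c(3)[of "\<lambda>_. 1"] nn_integral_eq_integral[OF int] \<beta>_nn by simp
  have "{p :: real ^ 'j. p $ i \<in> X} \<in> sets borel"
    using measurable_sets[OF borel_measurable_vec_nth assms(3), of i] by (simp add: vimage_def)
  then have "emeasure (dirichlet tau) {p. p $ i \<in> X}
      = (\<integral>\<^sup>+ p. indicator X (p $ i) * dirichlet_kernel tau p \<partial>sum1_lborel) / (\<integral>\<^sup>+ p. dirichlet_kernel tau p \<partial>sum1_lborel)"
    by (subst emeasure_dirichlet) (auto simp: indicator_def)
  also have "(\<integral>\<^sup>+ p. indicator X (p $ i) * dirichlet_kernel tau p \<partial>sum1_lborel)
      = c * (\<integral>\<^sup>+ x. indicator X x * ennreal (\<beta> x) \<partial>lborel)"
    by (rule c(3)) measurable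
  also have "(\<integral>\<^sup>+ x. indicator X x * ennreal (\<beta> x) \<partial>lborel) = ennreal (\<integral>x. indicator X x * \<beta> x \<partial>lborel)"
    using nn_integral_eq_integral[OF int'] \<beta>_nn by (simp add: ennreal_mult' ennreal_indicator)
  also have "c * ennreal (\<integral>x. indicator X x * \<beta> x \<partial>lborel) / (\<integral>\<^sup>+ p. dirichlet_kernel tau p \<partial>sum1_lborel)
      = ennreal (\<integral>x. indicator X x * \<beta> x \<partial>lborel) / ennreal (\<integral>x. \<beta> x \<partial>lborel)"
    unfolding tot mult.commute[of c] using c(1,2) by (intro divide_mult_eq) auto
  also have "\<dots> = ennreal ((\<integral>x. indicator X x * \<beta> x \<partial>lborel) / (\<integral>x. \<beta> x \<partial>lborel))"
  proof (rule divide_ennreal)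
    show "0 \<le> (\<integral>x. indicator X x * \<beta> x \<partial>lborel)" using \<beta>_nn by (intro Bochner_Integration.integral_nonneg) auto
    show "0 < (\<integral>x. \<beta> x \<partial>lborel)"
      using pos(1) nn_integral_eq_integral[OF int] \<beta>_nn by simp
  qed
  finally show ?thesis
    using \<beta>_nn by (simp add: measure_def)
qed

section \<open>Quantiles and symmetric intervals of the standard normal law\<close>

interpretation std_normal: real_distribution std_normal_distribution
  by (rule real_dist_normal_dist)

text \<open>Right continuity of the distribution function shows that the infimum defining
  \<open>quantile\<close> still satisfies the defining inequality.\<close>

lemma le_cdf_quantile:
  assumes "0 < q" "q < 1"
  shows "q \<le> cdf std_normal_distribution (quantile std_normal_distribution q)"
proof -
  let ?F = "cdf std_normal_distribution"
  define A z where "A = {z. q \<le> ?F z}" and "z = Inf A"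
  have "\<forall>\<^sub>F x in at_top. q < ?F x"
    using order_tendstoD(1)[OF std_normal.cdf_lim_at_top_prob] assms by blast
  then obtain x where "q < ?F x" by (meson eventually_happens trivial_limit_at_top_linorder)
  then have A_ne: "A \<noteq> {}" by (auto simp: A_def intro: less_imp_le)
  have "(?F \<longlongrightarrow> ?F z) (at_right z)"
    using std_normal.cdf_is_right_cont[of z] by (simp add: continuous_within)
  then have "q \<le> ?F z"
  proof (rule tendsto_lowerbound)
    show "\<forall>\<^sub>F y in at_right z. q \<le> ?F y"
      unfolding eventually_at_right_field
    proof (intro exI[of _ "z + 1"] conjI allI impI)
      fix y assume "z < y" "y < z + 1"
      then obtain a where "a \<in> A" "a < y" using cInf_lessD[OF A_ne, of y] by (auto simp: z_def)
      then show "q \<le> ?F y"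
        using std_normal.cdf_nondecreasing[of a y] by (auto simp: A_def)
    qed simp
  qed simp
  then show ?thesis by (simp add: quantile_def z_def A_def)
qed

text \<open>The two tails have equal mass by reflection. Subadditivity over a cover of the line,
  rather than additivity over a partition, makes the estimate valid for either sign of
  \<open>z\<close>.\<close>

lemma std_normal_symmetric_interval:
  "2 * cdf std_normal_distribution z - 1 \<le> (\<integral>t. indicator {-z..z} t * std_normal_density t \<partial>lborel)"
proof -
  let ?M = std_normal_distribution
  have emeas: "emeasure ?M X = (\<integral>\<^sup>+ t. ennreal (std_normal_density t) * indicator X t \<partial>lborel)"
    if "X \<in> sets borel" for X
    using that by (intro emeasure_density) auto
  have "emeasure ?M {..<-z} = emeasure ?M {z<..}"
  proof -
    have "emeasure ?M {..<-z}
        = (\<integral>\<^sup>+ t. ennreal (std_normal_density (0 + (-1) * t)) * indicator {..<-z} (0 + (-1) * t) \<partial>lborel)"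
      by (subst emeas) (auto intro!: trans[OF nn_integral_real_affine[of _ "-1" 0]])
    also have "\<dots> = emeasure ?M {z<..}"
      by (subst emeas) (auto simp: std_normal_density_def indicator_def intro!: nn_integral_cong)
    finally show ?thesis .
  qed
  then have tails: "measure ?M {..<-z} = measure ?M {z<..}" by (simp add: measure_def)
  have "measure ?M {z<..} = 1 - cdf ?M z"
  proof -
    have "{z<..} = space ?M - {..z}" by auto
    then show ?thesis unfolding cdf_def by (metis std_normal.prob_compl std_normal.sets_M borel_closed closed_atMost)
  qed
  moreover have "1 \<le> measure ?M {-z..z} + measure ?M {..<-z} + measure ?M {z<..}"
  proof -
    have "1 = measure ?M (({-z..z} \<union> {..<-z}) \<union> {z<..})"
    proof -
      have "({-z..z} \<union> {..<-z}) \<union> {z<..} = space ?M" by auto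
      then show ?thesis using std_normal.prob_space by simp
    qed
    also have "\<dots> \<le> measure ?M ({-z..z} \<union> {..<-z}) + measure ?M {z<..}"
      by (rule measure_Un_le) auto
    also have "measure ?M ({-z..z} \<union> {..<-z}) \<le> measure ?M {-z..z} + measure ?M {..<-z}"
      by (rule measure_Un_le) auto
    finally show ?thesis by simp
  qed
  moreover have "measure ?M {-z..z} = (\<integral>t. indicator {-z..z} t * std_normal_density t \<partial>lborel)"
  proof -
    have "measure ?M {-z..z} = (\<integral>t. indicator {-z..z} t \<partial>?M)" by simp
    also have "\<dots> = (\<integral>t. std_normal_density t *\<^sub>R indicator {-z..z} t \<partial>lborel)"
      by (rule integral_density) auto
    finally show ?thesis by (simp add: mult.commute)
  qed
  ultimately show ?thesis using tails by linarith
qed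

section \<open>Asymptotic coverage of the ambiguity set\<close>

lemma ambiguity_measurable [measurable]: "ambiguity alpha tau \<in> sets borel"
proof -
  have "closed (ambiguity alpha tau)"
  proof -
    have "closed {q. \<forall>j. p $ j - r $ j \<le> q $ j \<and> q $ j \<le> p $ j + r $ j}" for p r :: "real ^ 'a"
      by (intro closed_Collect_all closed_Collect_conj closed_Collect_le continuous_intros)
    from closed_Int[OF closed_prob_vecs this] show ?thesis
      unfolding ambiguity_def box_set_def Int_def mem_Collect_eq .
  qed
  then show ?thesis by (rule borel_closed)
qed

text \<open>Each coordinate misses its interval with a limiting probability of at most
  \<open>alpha / J\<close>; summing over the \<open>J\<close> coordinates explains the Bonferroni
  level in \<open>r_hat\<close>.\<close>

lemma dirichlet_ambiguity_ge:
  fixes tau :: "nat \<Rightarrow> real ^ 'j::finite"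
  assumes tau: "\<And>N j. 1 < tau N $ j" and lim: "\<And>j. filterlim (\<lambda>N. tau N $ j) at_top sequentially"
    and alpha: "0 < alpha" "alpha < 1"
  shows "\<exists>e :: nat \<Rightarrow> real. e \<longlonglongrightarrow> 0 \<and>
    (\<forall>N. 1 - alpha + e N \<le> measure (dirichlet (tau N)) (ambiguity alpha (tau N)))"
proof -
  let ?J = "real CARD('j)"
  have tau': "1 \<le> tau N $ j" for N j using tau[of N j] by simp
  have ps: "prob_space (dirichlet (tau N))" for N using tau' by (intro prob_space_dirichlet)
  have AE_mem: "AE p in dirichlet (tau N). p \<in> prob_vecs" for N
    using AE_dirichlet[of "tau N"] by eventually_elim simp
  show ?thesis
  proof (cases "CARD('j) \<ge> 2")
    case True
    define B where "B = (\<lambda>N j. {p_hat (tau N) $ j - r_hat alpha (tau N) $ j..p_hat (tau N) $ j + r_hat alpha (tau N) $ j})"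
    define \<rho> where "\<rho> = (\<lambda>N j. measure (dirichlet (tau N)) {p. p $ j \<in> B N j})"
    define z where "z = quantile std_normal_distribution (1 - (alpha / ?J) / 2)"
    define L where "L = (\<integral>t. indicator {-z..z} t * std_normal_density t \<partial>lborel)"
    have L: "1 - alpha / ?J \<le> L"
    proof -
      have "alpha / ?J \<le> alpha / 1" using True alpha by (intro divide_left_mono) auto
      then have "alpha / ?J < 1" using alpha by linarith
      moreover have "0 < alpha / ?J" using alpha by simp
      ultimately have "1 - (alpha / ?J) / 2 \<le> cdf std_normal_distribution z"
        unfolding z_def by (intro le_cdf_quantile) auto
      then show ?thesis using std_normal_symmetric_interval[of z] by (simp add: L_def)
    qed
    have \<rho>: "(\<lambda>N. \<rho> N j) \<longlonglongrightarrow> L" for j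
    proof -
      define b where "b = (\<lambda>N. \<Sum>l\<in>UNIV - {j}. tau N $ l)"
      have sum_eq: "(\<Sum>l\<in>UNIV. tau N $ l) = tau N $ j + b N" for N
        by (simp add: b_def sum.remove[of UNIV j])
      \<comment> \<open>One further coordinate, whose parameter diverges, already forces the
        complementary parameter \<open>b\<close> to diverge.\<close>
      obtain l where l: "l \<noteq> j"
      proof -
        have "\<not> UNIV \<subseteq> {j}"
          using True card_mono[of "{j}" "UNIV :: 'j set"] by auto
        then show ?thesis using that by blast
      qed
      have "tau N $ l \<le> b N" for N
        unfolding b_def using l tau' by (intro member_le_sum) (auto intro: order_trans[OF zero_le_one])
      then have b: "filterlim b at_top sequentially"
        by (intro filterlim_at_top_mono[OF lim[of l]]) simp
      have "\<rho> N j = (\<integral>x. indicator (B N j) x * beta_kernel (tau N $ j - 1) (b N - 1) x \<partial>lborel)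
          / (\<integral>x. beta_kernel (tau N $ j - 1) (b N - 1) x \<partial>lborel)" for N
        unfolding \<rho>_def b_def using tau' by (intro measure_dirichlet_component True) (auto simp: B_def)
      moreover have "B N j = {(tau N $ j - 1) / (tau N $ j + b N - ?J)
            - z * sqrt ((tau N $ j - 1) / (tau N $ j + b N - ?J) * (1 - (tau N $ j - 1) / (tau N $ j + b N - ?J)) / (tau N $ j + b N - ?J))
          ..(tau N $ j - 1) / (tau N $ j + b N - ?J)
            + z * sqrt ((tau N $ j - 1) / (tau N $ j + b N - ?J) * (1 - (tau N $ j - 1) / (tau N $ j + b N - ?J)) / (tau N $ j + b N - ?J))}" for N
        unfolding B_def p_hat_def r_hat_def z_def sum_eq by simp
      ultimately show ?thesis
        unfolding L_def using beta_credible_interval_tendsto[OF lim[of j] b, where J = ?J and z = z] by (simp only:)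
    qed
    define low where "low = (\<lambda>N. 1 - (\<Sum>j\<in>UNIV. 1 - \<rho> N j))"
    have low_lim: "low \<longlonglongrightarrow> 1 - (\<Sum>j\<in>(UNIV :: 'j set). 1 - L)"
      unfolding low_def by (intro tendsto_intros \<rho>)
    have low_ge: "1 - alpha \<le> 1 - (\<Sum>j\<in>(UNIV :: 'j set). 1 - L)"
    proof -
      have "?J * (1 - L) \<le> ?J * (alpha / ?J)" using L by (intro mult_left_mono) auto
      then show ?thesis by simp
    qed
    have low_le: "low N \<le> measure (dirichlet (tau N)) (ambiguity alpha (tau N))" for N
    proof -
      interpret prob_space "dirichlet (tau N)" by (rule ps)
      have meas: "{p :: real ^ 'j. p $ j \<in> B N j} \<in> sets borel" for j
        using measurable_sets[OF borel_measurable_vec_nth, of "B N j" j] by (simp add: vimage_def B_def)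
      have compl: "prob (- {p. p $ j \<in> B N j}) = 1 - \<rho> N j" for j
        using prob_compl[of "{p. p $ j \<in> B N j}"] meas[of j] by (simp add: \<rho>_def Compl_eq_Diff_UNIV)
      have "1 - prob (ambiguity alpha (tau N)) = prob (- ambiguity alpha (tau N))"
        using prob_compl[of "ambiguity alpha (tau N)"] by (simp add: Compl_eq_Diff_UNIV)
      also have "\<dots> \<le> prob (\<Union>j. - {p. p $ j \<in> B N j})"
      proof (rule finite_measure_mono_AE)
        \<comment> \<open>Outside the simplex a vector may miss the ambiguity set while all its
          coordinates lie in their intervals, so the inclusion holds only almost everywhere.\<close>
        show "AE p in dirichlet (tau N). p \<in> - ambiguity alpha (tau N) \<longrightarrow> p \<in> (\<Union>j. - {p. p $ j \<in> B N j})"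
          using AE_mem[of N] by eventually_elim (auto simp: ambiguity_def box_set_def B_def)
        show "(\<Union>j. - {p. p $ j \<in> B N j}) \<in> events"
          using meas by (auto simp: Compl_eq_Diff_UNIV intro!: sets.countable_UN sets.Diff)
      qed
      also have "\<dots> \<le> (\<Sum>j\<in>UNIV. prob (- {p. p $ j \<in> B N j}))"
        using meas by (intro finite_measure_subadditive_finite) (auto simp: Compl_eq_Diff_UNIV intro!: sets.Diff)
      finally show ?thesis by (simp add: compl low_def)
    qed
    let ?l = "1 - (\<Sum>j\<in>(UNIV :: 'j set). 1 - L)"
    show ?thesis
    \<comment> \<open>The error term is the deviation of the union bound from its limit
      \<open>?l\<close>, which is itself at least \<open>1 - alpha\<close>.\<close>
    proof (intro exI[of _ "\<lambda>N. low N - ?l"] conjI allI)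
      show "(\<lambda>N. low N - ?l) \<longlonglongrightarrow> 0" using low_lim by (rule LIM_zero)
      show "1 - alpha + (low N - ?l) \<le> measure (dirichlet (tau N)) (ambiguity alpha (tau N))" for N
        using low_le[of N] low_ge by linarith
    qed
  next
    case False
    then have J: "CARD('j) = 1" using zero_less_card_finite[where 'a = 'j] by linarith
    then obtain i :: 'j where i: "UNIV = {i}" by (auto simp: card_1_singleton_iff)
    then have all: "l = i" for l by auto
    \<comment> \<open>With one point the centre is 1 and the radius 0, and the ambiguity set is the
      whole, one-element simplex.\<close>
    have mem: "p \<in> ambiguity alpha (tau N)" if "p \<in> prob_vecs" for p N
    proof -
      have "p $ i = 1" using that by (simp add: prob_vecs_def i)
      moreover have "p_hat (tau N) $ i = 1" using tau[of N i] by (simp add: p_hat_def i J)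
      moreover have "r_hat alpha (tau N) $ i = 0" using calculation by (simp add: r_hat_def)
      ultimately have "\<forall>j. p_hat (tau N) $ j - r_hat alpha (tau N) $ j \<le> p $ j \<and> p $ j \<le> p_hat (tau N) $ j + r_hat alpha (tau N) $ j"
        using all by (metis add.right_neutral diff_zero order_refl)
      then show ?thesis using that by (simp add: ambiguity_def box_set_def)
    qed
    have "AE p in dirichlet (tau N). p \<in> ambiguity alpha (tau N)" for N
      using AE_mem[of N] by eventually_elim (rule mem)
    then have "measure (dirichlet (tau N)) (ambiguity alpha (tau N)) = 1" for N
      using prob_space.prob_eq_1[OF ps, of "ambiguity alpha (tau N)" N] by simp
    then show ?thesis using alpha by (intro exI[of _ "\<lambda>_. 0"]) simp
  qed
qed

section \<open>Observation sequences and growth of the posterior parameters\<close>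

lemma emeasure_law:
  fixes xi :: "'j::finite \<Rightarrow> real ^ 'k"
  assumes "X \<in> sets borel"
  shows "emeasure (law xi P) X = (\<Sum>j\<in>xi -` X. ennreal (P $ j))"
proof -
  have "emeasure (law xi P) X = emeasure (point_measure UNIV (\<lambda>j. ennreal (P $ j))) (xi -` X)"
    unfolding law_def using assms
    by (subst emeasure_distr) (auto simp: measurable_def space_point_measure sets_point_measure)
  then show ?thesis by (simp add: emeasure_point_measure_finite)
qed

lemma sets_law [simp, measurable_cong]: "sets (law xi P) = sets borel"
  by (simp add: law_def)

lemma prob_space_law:
  assumes "P \<in> prob_vecs"
  shows "prob_space (law xi P)"
proof (rule prob_spaceI)
  have "space (law xi P) = UNIV" by (simp add: law_def)
  then show "emeasure (law xi P) (space (law xi P)) = 1"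
    using assms by (simp add: emeasure_law sum_ennreal prob_vecs_iff)
qed

text \<open>Never seeing the point from time \<open>n\<close> on entails missing it in every window
  of length \<open>k\<close>, which has probability at most \<open>c ^ k\<close> with
  \<open>c < 1\<close>. A countable intersection over \<open>n\<close> finishes the
  argument.\<close>

lemma AE_iid_infinitely_often:
  assumes "P \<in> prob_vecs" and "0 < P $ j"
  shows "AE x in (\<Pi>\<^sub>M i\<in>(UNIV :: nat set). law xi P). infinite {i. x i = xi j}"
proof -
  let ?M = "\<Pi>\<^sub>M i\<in>(UNIV :: nat set). law xi P"
  interpret product_prob_space "\<lambda>_ :: nat. law xi P" UNIV
    unfolding product_prob_space_def product_prob_space_axioms_def product_sigma_finite_def
    using prob_space_law[OF assms(1)] by (auto intro: prob_space_imp_sigma_finite)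
  define c where "c = 1 - P $ j"
  have "P $ j \<le> 1" using assms(1) by (simp add: prob_vecs_def)
  then have c: "0 \<le> c" "c < 1" using assms(2) by (auto simp: c_def)
  have single: "emeasure (law xi P) (- {xi j}) \<le> ennreal c"
  proof -
    have "emeasure (law xi P) (- {xi j}) = ennreal (\<Sum>l\<in>xi -` (- {xi j}). P $ l)"
      using assms(1) by (simp add: emeasure_law sum_ennreal prob_vecs_iff)
    also have "(\<Sum>l\<in>xi -` (- {xi j}). P $ l) \<le> (\<Sum>l\<in>UNIV - {j}. P $ l)"
      using assms(1) by (intro sum_mono2) (auto simp: prob_vecs_iff)
    also have "\<dots> = c"
      using assms(1) by (simp add: sum_diff1 prob_vecs_iff c_def)
    finally show ?thesis by (simp add: ennreal_leI)
  qed
  have "AE x in ?M. \<exists>i\<ge>n. x i = xi j" for n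
  proof -
    define E where "E = {x \<in> space ?M. \<forall>i\<in>{n..}. x i \<in> - {xi j}}"
    have E: "E \<in> sets ?M"
    proof -
      have [measurable]: "- {xi j} \<in> sets borel" by simp
      show ?thesis unfolding E_def by measurable
    qed
    have "emeasure ?M E \<le> ennreal (c ^ k)" for k
    proof -
      have "E \<subseteq> {x \<in> space ?M. \<forall>i\<in>{n..<n+k}. x i \<in> - {xi j}}"
        by (auto simp: E_def)
      then have "emeasure ?M E \<le> emeasure ?M {x \<in> space ?M. \<forall>i\<in>{n..<n+k}. x i \<in> - {xi j}}"
        by (rule emeasure_mono) measurable
      also have "\<dots> = (\<Prod>i\<in>{n..<n+k}. emeasure (law xi P) (- {xi j}))"
        by (rule emeasure_PiM_Collect) auto
      also have "\<dots> \<le> (\<Prod>i\<in>{n..<n+k}. ennreal c)"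
        by (intro prod_mono_ennreal single)
      also have "\<dots> = ennreal (c ^ k)" using c by (simp add: ennreal_power)
      finally show ?thesis .
    qed
    moreover have "(\<lambda>k. ennreal (c ^ k)) \<longlonglongrightarrow> ennreal 0"
      using c by (intro tendsto_ennrealI LIMSEQ_realpow_zero) auto
    ultimately have "emeasure ?M E \<le> ennreal 0"
      by (intro LIMSEQ_le_const) auto
    then have "E \<in> null_sets ?M" using E by (auto simp: null_sets_def)
    from AE_not_in[OF this] show ?thesis
      by (rule AE_mp) (auto simp: E_def intro!: AE_I2)
  qed
  then have "AE x in ?M. \<forall>n. \<exists>i\<ge>n. x i = xi j" by (simp add: AE_all_countable)
  then show ?thesis
    by eventually_elim (simp add: infinite_nat_iff_unbounded_le)
qed

lemma filterlim_count_at_top: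
  assumes "infinite {i. Q i}"
  shows "filterlim (\<lambda>N. \<Sum>i<N. of_bool (Q i) :: real) at_top sequentially"
  unfolding filterlim_at_top
proof
  fix Z :: real
  obtain T where T: "finite T" "card T = nat \<lceil>Z\<rceil>" "T \<subseteq> {i. Q i}"
    using infinite_arbitrarily_large[OF assms] by blast
  obtain N0 where N0: "T \<subseteq> {..<N0}" using T(1) finite_nat_iff_bounded by blast
  have "Z \<le> (\<Sum>i<N. of_bool (Q i))" if "N \<ge> N0" for N
  proof -
    have "Z \<le> real (card T)" using T(2) by linarith
    also have "\<dots> = (\<Sum>i\<in>T. of_bool (Q i))" using T(3) by (simp add: subset_iff)
    also have "\<dots> \<le> (\<Sum>i<N. of_bool (Q i))" using N0 that by (intro sum_mono2) auto
    finally show ?thesis .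
  qed
  then show "\<forall>\<^sub>F N in sequentially. Z \<le> (\<Sum>i<N. of_bool (Q i))"
    unfolding eventually_sequentially by blast
qed

lemma posterior_par_ge: "tau0 $ j \<le> posterior_par xi tau0 x N $ j"
  by (simp add: posterior_par_def sum_nonneg)

text \<open>A deterministic statement about one observation sequence: the randomness of the data is
  needed only to supply \<open>inf\<close>.\<close>

lemma (in weighted_mdp) posterior_bound_if_infinitely_often:
  assumes tau0: "\<And>j. 1 < tau0 $ j" and alpha: "0 < alpha" "alpha < 1"
    and inf: "\<And>j. infinite {i. x i = xi j}"
  shows "posterior_bound S A w xi C g gamma tau0 alpha x"
  unfolding posterior_bound_def
proof (intro allI impI)
  let ?tau = "posterior_par xi tau0 x"
  fix pol assume opt: "\<forall>N. robust_optimal S A w xi C g gamma (ambiguity alpha (?tau N)) (pol N)"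
  have tau: "1 < ?tau N $ j" for N j
    using tau0[of j] posterior_par_ge[of tau0 j xi x N] by simp
  have "filterlim (\<lambda>N. ?tau N $ j) at_top sequentially" for j
    unfolding posterior_par_def
    using filterlim_tendsto_add_at_top[OF tendsto_const filterlim_count_at_top[OF inf[of j]], of "tau0 $ j"] by simp
  from dirichlet_ambiguity_ge[OF tau this alpha] obtain e :: "nat \<Rightarrow> real" where e: "e \<longlonglongrightarrow> 0"
    "\<And>N. 1 - alpha + e N \<le> measure (dirichlet (?tau N)) (ambiguity alpha (?tau N))" by blast
  let ?G = "\<lambda>N. {P \<in> prob_vecs. \<forall>s\<in>S. policy_value S w xi C g gamma P (pol N) s
    \<le> robust_value S A w xi C g gamma (ambiguity alpha (?tau N)) s}"
  have "1 - alpha + e N \<le> measure (dirichlet (?tau N)) (?G N)" for N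
  proof -
    interpret prob_space "dirichlet (?tau N)"
      using tau by (intro prob_space_dirichlet) (auto intro: less_imp_le)
    have sub: "ambiguity alpha (?tau N) \<subseteq> prob_vecs" by (auto simp: ambiguity_def box_set_def)
    have "pol N \<in> S \<rightarrow> A" using opt by (simp add: robust_optimal_def)
    \<comment> \<open>Monotonicity of the measure requires the larger set to be measurable.\<close>
    then have "?G N \<in> sets borel"
      by (intro borel_closed closed_policy_value_le closed_prob_vecs)
    moreover have "ambiguity alpha (?tau N) \<subseteq> ?G N"
      using sub policy_value_le_robust_value[OF sub] opt by blast
    ultimately have "measure (dirichlet (?tau N)) (ambiguity alpha (?tau N)) \<le> measure (dirichlet (?tau N)) (?G N)"
      by (intro finite_measure_mono) auto
    with e(2)[of N] show ?thesis by linarith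
  qed
  with e(1) show "\<exists>e. e \<longlonglongrightarrow> 0 \<and> (\<forall>N. 1 - alpha + e N \<le> measure (dirichlet (?tau N)) (?G N))" by blast
qed

text \<open>The vanishing term belongs to a fixed observation sequence, so the bound holds for
  almost every sequence of data. This is given both for each true distribution with positive masses
  and for prior-almost every one; the latter follows because the prior is concentrated on such
  distributions.\<close>

theorem theorem4:
  fixes S :: "(real ^ 'm) set" and A :: "(real ^ 'n) set"
    and xi :: "'j::finite \<Rightarrow> real ^ 'k"
    and C :: "real ^ 'm \<Rightarrow> real ^ 'n \<Rightarrow> real ^ 'k \<Rightarrow> real"
    and g :: "real ^ 'm \<Rightarrow> real ^ 'n \<Rightarrow> real ^ 'k \<Rightarrow> real ^ 'm"
    and w :: "real ^ 'm \<Rightarrow> real"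
    and tau0 :: "real ^ 'j"
    and gamma alpha Cbar kappa :: real
  assumes "closed S" "S \<noteq> {}" "closed A" "A \<noteq> {}" "inj xi"
    and "\<And>s a j. s \<in> S \<Longrightarrow> a \<in> A \<Longrightarrow> g s a (xi j) \<in> S"
    and "0 \<le> gamma" "gamma < 1"
    and "\<And>j. tau0 $ j > 1"
    and "0 < alpha" "alpha < 1"
    and "continuous_on S w" "\<And>s. s \<in> S \<Longrightarrow> 1 \<le> w s"
    and "compact A"
    and "\<And>j. continuous_on (S \<times> A) (\<lambda>(s, a). C s a (xi j))"
    and "\<And>j. continuous_on (S \<times> A) (\<lambda>(s, a). g s a (xi j))"
    and "0 < Cbar" "0 \<le> kappa"
    and "\<And>s a j. s \<in> S \<Longrightarrow> a \<in> A \<Longrightarrow> \<bar>C s a (xi j)\<bar> \<le> Cbar * w s"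
    and "\<And>s a j. s \<in> S \<Longrightarrow> a \<in> A \<Longrightarrow> w (g s a (xi j)) \<le> kappa * w s"
    and "gamma * kappa < 1"
  shows "(AE Pc in dirichlet tau0. AE x in (\<Pi>\<^sub>M i\<in>(UNIV :: nat set). law xi Pc).
            posterior_bound S A w xi C g gamma tau0 alpha x)
       \<and> (\<forall>Pc\<in>prob_vecs. (\<forall>j. Pc $ j > 0) \<longrightarrow>
            (AE x in (\<Pi>\<^sub>M i\<in>(UNIV :: nat set). law xi Pc).
               posterior_bound S A w xi C g gamma tau0 alpha x))"
proof -
  interpret weighted_mdp S A w xi C g gamma Cbar kappa
    using assms by unfold_locales auto
  have *: "AE x in (\<Pi>\<^sub>M i\<in>(UNIV :: nat set). law xi Pc). posterior_bound S A w xi C g gamma tau0 alpha x"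
    if "Pc \<in> prob_vecs" "\<forall>j. 0 < Pc $ j" for Pc
  proof -
    have "AE x in (\<Pi>\<^sub>M i\<in>(UNIV :: nat set). law xi Pc). \<forall>j. infinite {i. x i = xi j}"
      unfolding AE_all_countable using that by (auto intro: AE_iid_infinitely_often)
    then show ?thesis
      by eventually_elim (rule posterior_bound_if_infinitely_often, use assms in auto)
  qed
  moreover have "AE Pc in dirichlet tau0. AE x in (\<Pi>\<^sub>M i\<in>(UNIV :: nat set). law xi Pc).
      posterior_bound S A w xi C g gamma tau0 alpha x"
    using AE_dirichlet[of tau0] by eventually_elim (use * in auto)
  ultimately show ?thesis by blast
qed

end
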